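(* Let $\Omega = E \times B$ be the product of a symmetric Cantor set $E \subset \mathbb{R}$ of positive Lebesgue measure and an arbitrary bounded, measurable set $B \subset \mathbb{R}^m$. Then $\Omega$ is not a spectral set in $\mathbb{R} \times \mathbb{R}^m$.
   Context: Symmetric Cantor set: let $\{\xi_k\}$, $k=1,2,\dots$, be a sequence of real numbers such that $0 < \xi_k < \frac12$ for all $k$. The symmetric Cantor set associated to the ratio sequence $\{\xi_k\}$ is the closed set $E(\xi_1,\xi_2,\dots) \subset \mathbb{R}$ obtained from the interval $[0,1]$ by a Cantor type construction, where at the $k$'th step one removes from each one of the intervals of the previous step a central open interval of relative length $1-2\xi_k$, so that after the $k$'th step one obtains $2^k$ closed intervals of common length $\xi_1 \cdots \xi_k$; $E(\xi_1,\xi_2,\dots)$ is the intersection over all $k$ of the unions of these $2^k$ intervals. A symmetric Cantor set is a set of the form $E(\xi_1,\xi_2,\dots)$ for some such sequence. A bounded, measurable set $\Omega \subset \mathbb{R}^d$ of positive Lebesgue measure is called spectral if there exists a countable set $\Lambda \subset \mathbb{R}^d$ such that the system of exponential functions $\{\exp 2\pi i \langle \lambda, x\rangle\}$, $\lambda \in \Lambda$, forms an orthogonal basis in $L^2(\Omega)$ (that is, the system is orthogonal and complete in $L^2(\Omega)$). In particular, spectrality includes the requirement that the set has positive measure. *)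

theory Defs
  imports "HOL-Analysis.Analysis"
begin

text \<open>
  The closed intervals present after step \<open>k\<close> of the construction, each represented by its pair of
  endpoints. The ratios are indexed from \<open>1\<close>: step \<open>Suc k\<close> uses \<open>\<xi> (Suc k)\<close>, and \<open>\<xi> 0\<close> is never used.
\<close>

primrec cantor_intervals :: "(nat \<Rightarrow> real) \<Rightarrow> nat \<Rightarrow> (real \<times> real) set" where
  "cantor_intervals \<xi> 0 = {(0, 1)}"
| "cantor_intervals \<xi> (Suc k) =
     (\<Union>(a, b)\<in>cantor_intervals \<xi> k.
        {(a, a + \<xi> (Suc k) * (b - a)), (b - \<xi> (Suc k) * (b - a), b)})"

text \<open>
  The two intervals that replace \<open>{a..b}\<close> are what remains after removing the open interval with the
  same centre and of relative length \<open>1 - 2 * r\<close>.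
\<close>

lemma remove_central_interval:
  fixes a b r :: real
  assumes "a \<le> b" "0 < r" "r < 1/2"
  defines "c \<equiv> (a + b) / 2" and "h \<equiv> (1 - 2 * r) * (b - a) / 2"
  shows "{a..b} - {c - h<..<c + h} = {a..a + r * (b - a)} \<union> {b - r * (b - a)..b}"
proof -
  have ch: "c - h = a + r * (b - a)" "c + h = b - r * (b - a)"
    unfolding c_def h_def by (simp_all add: field_simps)
  have "r * (b - a) \<le> b - a" "0 \<le> r * (b - a)"
    using assms(1-3) by (auto intro!: mult_left_le_one_le mult_nonneg_nonneg)
  then show ?thesis
    unfolding ch by auto
qed

definition cantor_set :: "(nat \<Rightarrow> real) \<Rightarrow> real set" where
  "cantor_set \<xi> = (\<Inter>k. \<Union>(a, b)\<in>cantor_intervals \<xi> k. {a..b})"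

definition symmetric_cantor_set :: "real set \<Rightarrow> bool" where
  "symmetric_cantor_set E \<longleftrightarrow>
     (\<exists>\<xi>. (\<forall>k\<ge>1. 0 < \<xi> k \<and> \<xi> k < 1/2) \<and> E = cantor_set \<xi>)"

definition exponential :: "'a::euclidean_space \<Rightarrow> 'a \<Rightarrow> complex" where
  "exponential l x = exp (2 * of_real pi * \<i> * of_real (l \<bullet> x))"

text \<open>
  Functions rather than classes modulo null sets; equality in \<open>L\<^sup>2\<close> plays no role below.
\<close>

definition square_integrable_on :: "('a::euclidean_space \<Rightarrow> complex) \<Rightarrow> 'a set \<Rightarrow> bool" where
  "square_integrable_on f S \<longleftrightarrow>
     f \<in> borel_measurable (lebesgue_on S) \<and> integrable (lebesgue_on S) (\<lambda>x. (cmod (f x))\<^sup>2)"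

definition orthogonal_exponentials :: "'a::euclidean_space set \<Rightarrow> 'a set \<Rightarrow> bool" where
  "orthogonal_exponentials L S \<longleftrightarrow>
     (\<forall>l\<in>L. \<forall>l'\<in>L. l \<noteq> l' \<longrightarrow>
        (LINT x|lebesgue_on S. exponential l x * cnj (exponential l' x)) = 0)"

text \<open>
  Completeness of the system: its linear span is dense in \<open>L\<^sup>2 S\<close>. For bounded measurable \<open>S\<close> the
  integrand below is always integrable, so the integral is the squared \<open>L\<^sup>2\<close> distance.
\<close>

definition complete_exponentials :: "'a::euclidean_space set \<Rightarrow> 'a set \<Rightarrow> bool" where
  "complete_exponentials L S \<longleftrightarrow>
     (\<forall>f. square_integrable_on f S \<longrightarrow>
        (\<forall>\<epsilon>>0. \<exists>F c. finite F \<and> F \<subseteq> L \<and>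
           sqrt (LINT x|lebesgue_on S. (cmod (f x - (\<Sum>l\<in>F. c l * exponential l x)))\<^sup>2) < \<epsilon>))"

definition spectral :: "'a::euclidean_space set \<Rightarrow> bool" where
  "spectral S \<longleftrightarrow>
     bounded S \<and> S \<in> sets lebesgue \<and> emeasure lebesgue S > 0 \<and>
     (\<exists>L. countable L \<and> orthogonal_exponentials L S \<and> complete_exponentials L S)"

end

theory Submission
  imports Defs
begin

text \<open>
  Suppose \<open>L\<close> is a spectrum of \<open>S = E \<times> B\<close>. For finite \<open>F \<subseteq> L\<close> let \<open>P\<close> be the sum of the exponentials in
  \<open>F\<close>, and consider the measure \<open>\<bar>P (x - y)\<bar>\<^sup>2 dx dy\<close>. Orthogonality gives \<open>A \<times> S\<close> the mass
  \<open>\<bar>F\<bar> \<bar>A\<bar> \<bar>S\<bar>\<close> for every \<open>A\<close>. Completeness, in the form of Parseval's identity for the indicator of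
  \<open>A \<subseteq> S\<close>, gives \<open>A \<times> A\<close> almost the mass \<open>\<bar>F\<bar> \<bar>A\<bar> \<bar>S\<bar>\<close> if \<open>F\<close> is the part of \<open>L\<close> in a suitable large
  ball. Cutting \<open>S\<close> into thin slices \<open>A\<close> shows that almost all of the mass of \<open>S \<times> S\<close> lies near the
  diagonal.

  On the other hand, at a deep level of the construction \<open>E\<close> almost fills its intervals, so there is
  a small gap \<open>J\<close> of \<open>E\<close> such that each translate of \<open>E\<close> that meets \<open>J\<close> is a translate by a
  non-negligible amount and overlaps \<open>E\<close> in a set of measure bounded below. Hence the mass
  \<open>\<bar>F\<bar> \<bar>J\<bar> \<bar>B\<bar> \<bar>S\<bar>\<close> of \<open>(J \<times> B) \<times> S\<close> is at most a constant times the mass of \<open>S \<times> S\<close> away from the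
  diagonal, a contradiction.
\<close>

section \<open>Exponentials and Fourier transforms of sets\<close>

lemma exponential_cis: "exponential l x = cis (2 * pi * (l \<bullet> x))"
  by (simp add: exponential_def cis_conv_exp mult_ac)

lemma norm_exponential [simp]: "cmod (exponential l x) = 1"
  by (simp add: exponential_cis)

lemma exponential_0 [simp]: "exponential 0 = (\<lambda>_. 1)"
  by (simp add: exponential_def fun_eq_iff)

lemma exponential_add_right: "exponential l (x + y) = exponential l x * exponential l y"
  by (simp add: exponential_cis inner_add_right distrib_left cis_mult)

lemma cnj_exponential: "cnj (exponential l x) = exponential (- l) x"
  by (simp add: exponential_cis cis_cnj)

lemma exponential_uminus_right: "exponential l (- x) = exponential (- l) x"
  by (simp add: exponential_cis)

lemma exponential_diff_left: "exponential (l - l') x = exponential l x * cnj (exponential l' x)"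
  by (simp add: exponential_cis inner_diff_left right_diff_distrib cis_cnj cis_mult)

lemma continuous_on_exponential: "continuous_on A (exponential l)"
  unfolding exponential_def by (intro continuous_intros)

lemma measurable_exponential [measurable]: "exponential l \<in> borel_measurable borel"
  by (intro borel_measurable_continuous_onI continuous_on_exponential)

lemma norm_one_minus_cis: "(cmod (1 - cis t))\<^sup>2 = 2 - 2 * cos t"
proof -
  have "(cmod (1 - cis t))\<^sup>2 = 1 - 2 * cos t + ((cos t)\<^sup>2 + (sin t)\<^sup>2)"
    unfolding cmod_power2 by (simp add: power2_eq_square algebra_simps)
  then show ?thesis by simp
qed

lemma norm_one_minus_cis_le: "cmod (1 - cis t) \<le> \<bar>t\<bar>"
proof (rule power2_le_imp_le)
  have "(cmod (1 - cis t))\<^sup>2 = (2 * \<bar>sin (t / 2)\<bar>)\<^sup>2"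
    using cos_double_sin[of "t / 2"] by (simp add: norm_one_minus_cis power_mult_distrib)
  also have "\<dots> \<le> (2 * \<bar>t / 2\<bar>)\<^sup>2"
    by (intro power_mono mult_left_mono abs_sin_x_le_abs_x) auto
  finally show "(cmod (1 - cis t))\<^sup>2 \<le> \<bar>t\<bar>\<^sup>2" by simp
qed simp

text \<open>The Fourier transform of the indicator of \<open>A\<close>, with a plus sign in the
  exponent. Integrals are taken against \<open>lborel\<close>, so that Borel sets, which are stable
  under translations and products, are the sets to work with.\<close>

definition ft :: "'a::euclidean_space set \<Rightarrow> 'a \<Rightarrow> complex" where
  "ft A \<xi> = (LINT x:A|lborel. exponential \<xi> x)"

lemma bounded_borel_fmeasurable:
  fixes A :: "'a::euclidean_space set"
  assumes "A \<in> sets borel" "bounded A"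
  shows "A \<in> fmeasurable lborel"
  using assms emeasure_bounded_finite[of A] by (intro fmeasurableI) auto

lemma set_integrable_exponential:
  fixes A :: "'a::euclidean_space set"
  assumes "A \<in> fmeasurable lborel"
  shows "set_integrable lborel A (exponential \<xi>)"
  unfolding set_integrable_def
proof (rule integrableI_bounded_set[where A=A and B=1])
  show "A \<in> sets lborel" "emeasure lborel A < \<infinity>"
    using assms by (auto simp: fmeasurable_def)
  then show "(\<lambda>x. indicat_real A x *\<^sub>R exponential \<xi> x) \<in> borel_measurable lborel"
    by simp
qed (auto simp: indicator_def)

lemma ft_0: "A \<in> fmeasurable lborel \<Longrightarrow> ft A 0 = measure lborel A"
  using set_integral_const[of A lborel "1::complex"]
  by (simp add: ft_def fmeasurable_def set_lebesgue_integral_def scaleR_conv_of_real)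

lemma ft_uminus: "ft A (- \<xi>) = cnj (ft A \<xi>)"
  unfolding ft_def set_lebesgue_integral_def
  unfolding Bochner_Integration.integral_cnj[symmetric] by (simp add: cnj_exponential)

lemma ft_translate:
  fixes A :: "'a::euclidean_space set"
  assumes [measurable]: "A \<in> sets borel"
  shows "ft {x. x - a \<in> A} \<xi> = exponential \<xi> a * ft A \<xi>"
proof -
  have "ft {x. x - a \<in> A} \<xi> =
      (LINT x|distr lborel borel ((+) a). indicator {x. x - a \<in> A} x *\<^sub>R exponential \<xi> x)"
    by (simp add: lborel_distr_plus ft_def set_lebesgue_integral_def)
  also have "\<dots> = (LINT x|lborel. indicator {x. x - a \<in> A} (a + x) *\<^sub>R exponential \<xi> (a + x))"
    by (rule integral_distr) simp_all
  also have "\<dots> = (LINT x|lborel. exponential \<xi> a * (indicator A x *\<^sub>R exponential \<xi> x))"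
    by (intro Bochner_Integration.integral_cong) (auto simp: exponential_add_right indicator_def)
  also have "\<dots> = exponential \<xi> a * ft A \<xi>"
    unfolding ft_def set_lebesgue_integral_def by (rule integral_mult_right_zero)
  finally show ?thesis .
qed

lemma measure_translate:
  fixes A :: "'a::euclidean_space set"
  assumes "A \<in> sets borel"
  shows "measure lborel {x. x - a \<in> A} = measure lborel A"
  using measure_distr[of "(+) (- a)" lborel borel A] assms
  by (simp add: lborel_distr_plus vimage_def)

text \<open>On \<open>A\<close> the phase is at most \<open>2 * pi * M * norm \<xi>\<close>, and
  \<open>cis t\<close> differs from 1 by at most |t|. For \<open>A = S\<close> this keeps the zeros
  of the transform away from the origin.\<close>

lemma norm_ft_diff_le:
  fixes A :: "'a::euclidean_space set"
  assumes A: "A \<in> fmeasurable lborel" "\<And>x. x \<in> A \<Longrightarrow> norm x \<le> M"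
  shows "cmod (ft A \<xi> - measure lborel A) \<le> 2 * pi * M * norm \<xi> * measure lborel A"
proof -
  have "ft A \<xi> - measure lborel A = (LINT x:A|lborel. exponential \<xi> x - 1)"
    using set_integrable_exponential[OF A(1), of \<xi>] set_integrable_exponential[OF A(1), of 0, simplified]
      ft_0[OF A(1)]
    by (subst set_integral_diff(2)) (simp_all add: ft_def)
  also have "cmod \<dots> \<le> (LINT x:A|lborel. cmod (exponential \<xi> x - 1))"
    using set_integrable_exponential[OF A(1), of \<xi>] set_integrable_exponential[OF A(1), of 0, simplified]
    by (intro set_integral_norm_bound set_integral_diff) auto
  also have "\<dots> \<le> (LINT x:A|lborel. 2 * pi * M * norm \<xi>)"
  proof (rule set_integral_mono)
    show "set_integrable lborel A (\<lambda>x. cmod (exponential \<xi> x - 1))"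
      using set_integrable_exponential[OF A(1), of \<xi>] set_integrable_exponential[OF A(1), of 0, simplified]
      by (intro set_integrable_norm set_integral_diff) auto
    show "set_integrable lborel A (\<lambda>x. 2 * pi * M * norm \<xi>)"
      using A(1) by (auto simp: fmeasurable_def set_integrable_def)
    fix x assume "x \<in> A"
    have "cmod (exponential \<xi> x - 1) \<le> \<bar>2 * pi * (\<xi> \<bullet> x)\<bar>"
      unfolding exponential_cis norm_minus_commute[of _ 1] by (rule norm_one_minus_cis_le)
    also have "\<dots> \<le> 2 * pi * (norm \<xi> * norm x)"
      using Cauchy_Schwarz_ineq2[of \<xi> x] by (simp add: abs_mult)
    also have "\<dots> \<le> 2 * pi * (norm \<xi> * M)"
      using A(2)[OF \<open>x \<in> A\<close>] by (intro mult_left_mono) auto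
    finally show "cmod (exponential \<xi> x - 1) \<le> 2 * pi * M * norm \<xi>" by (simp add: mult_ac)
  qed
  also have "\<dots> = 2 * pi * M * norm \<xi> * measure lborel A"
    using A(1) by (simp add: fmeasurable_def set_lebesgue_integral_def)
  finally show ?thesis .
qed

text \<open>Here \<open>{x. x - a \<in> A}\<close> is the translate \<open>A + a\<close>. The set is
  squeezed between a compact \<open>K\<close> and an open \<open>U\<close> that differ by at most
  \<epsilon>. A shift shorter than the distance from \<open>K\<close> to the complement of
  \<open>U\<close> keeps \<open>K + a\<close> inside \<open>U\<close>, and then \<open>A\<close>
  minus \<open>A + a\<close> lies in \<open>U\<close> minus \<open>K + a\<close>, of measure |U| -
  |K|.\<close>

lemma translation_continuity:
  fixes A :: "'a::euclidean_space set"
  assumes A: "A \<in> sets borel" "bounded A" and "\<epsilon> > 0"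
  obtains \<eta> where "\<eta> > 0" "\<And>a. norm a \<le> \<eta> \<Longrightarrow> measure lborel (A - {x. x - a \<in> A}) \<le> \<epsilon>"
proof -
  have leb: "A \<in> sets lebesgue" using A by simp
  obtain U where U: "open U" "A \<subseteq> U" "U - A \<in> lmeasurable" "emeasure lebesgue (U - A) < ennreal (\<epsilon> / 2)"
    using sets_lebesgue_outer_open[OF leb, of "\<epsilon> / 2"] \<open>\<epsilon> > 0\<close> by auto
  obtain K where K: "closed K" "K \<subseteq> A" "A - K \<in> lmeasurable" "emeasure lebesgue (A - K) < ennreal (\<epsilon> / 2)"
    using sets_lebesgue_inner_closed[OF leb, of "\<epsilon> / 2"] \<open>\<epsilon> > 0\<close> by auto
  have "compact K"
    using K A(2) by (auto simp: compact_eq_bounded_closed intro: bounded_subset)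
  have bor [measurable]: "A \<in> sets borel" "K \<in> sets borel" "U \<in> sets borel"
    using A K U by auto
  have small: "measure lborel (U - A) \<le> \<epsilon> / 2" "measure lborel (A - K) \<le> \<epsilon> / 2"
    unfolding measure_def
    by (rule enn2real_leI; use U(4) K(4) \<open>\<epsilon> > 0\<close> in simp)+
  have fin: "U - A \<in> fmeasurable lborel" "A - K \<in> fmeasurable lborel"
    using order.strict_trans[OF U(4) ennreal_less_top] order.strict_trans[OF K(4) ennreal_less_top] bor
    by (auto intro!: fmeasurableI)
  have "K \<inter> (- U) = {}" using K(2) U(2) by auto
  then obtain d where d: "d > 0" "\<And>x y. x \<in> K \<Longrightarrow> y \<in> - U \<Longrightarrow> d \<le> dist x y"
    using separate_compact_closed[OF \<open>compact K\<close>, of "- U"] U(1) by (auto simp: closed_Compl)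
  show thesis
  proof
    show "d / 2 > 0" using d by simp
    fix a :: 'a assume a: "norm a \<le> d / 2"
    have Ka: "{x. x - a \<in> K} \<subseteq> U"
    proof (rule ccontr)
      assume "\<not> {x. x - a \<in> K} \<subseteq> U"
      then obtain x where "x - a \<in> K" "x \<in> - U" by auto
      from d(2)[OF this] d(1) a show False by (simp add: dist_norm)
    qed
    have Af: "A \<in> fmeasurable lborel" using A by (rule bounded_borel_fmeasurable)
    have Kf: "K \<in> fmeasurable lborel" using \<open>compact K\<close> by (rule fmeasurable_compact)
    have Uf: "U \<in> fmeasurable lborel"
      using fmeasurable.Un[OF fin(1) Af] U(2) by (simp add: Un_absorb2)
    have Kam [measurable]: "{x. x - a \<in> K} \<in> sets borel" by measurable
    have "measure lborel (A - {x. x - a \<in> A}) \<le> measure lborel (U - {x. x - a \<in> K})"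
      using U(2) K(2) fmeasurableI2[OF Uf Ka]
      by (intro measure_mono_fmeasurable fmeasurable.Diff Uf) auto
    also have "\<dots> = measure lborel U - measure lborel {x. x - a \<in> K}"
      using Ka Uf by (intro measure_Diff) (auto simp: fmeasurable_def)
    also have "\<dots> = measure lborel U - measure lborel K"
      by (simp add: measure_translate)
    also have "\<dots> = measure lborel (U - A) + measure lborel (A - K)"
      using U(2) K(2) Uf Af Kf by (subst (1 2) measure_Diff) (auto simp: fmeasurable_def)
    also have "\<dots> \<le> \<epsilon>" using small by simp
    finally show "measure lborel (A - {x. x - a \<in> A}) \<le> \<epsilon>" .
  qed
qed

text \<open>The integrand is the squared modulus of \<open>1 - cis (s * k)\<close>. Integrating over
  \<open>s\<close> turns a bound for each shift into a bound on the high frequencies.\<close>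

lemma integral_one_minus_cos:
  fixes k \<eta> :: real
  assumes "k \<noteq> 0" "\<eta> \<ge> 0"
  shows "((\<lambda>s. 2 - 2 * cos (s * k)) has_integral (2 * \<eta> - 2 * sin (\<eta> * k) / k)) {0..\<eta>}"
proof -
  have "((\<lambda>s. 2 - 2 * cos (s * k)) has_integral
      ((2 * \<eta> - 2 * sin (\<eta> * k) / k) - (2 * 0 - 2 * sin (0 * k) / k))) {0..\<eta>}"
    using assms
    by (intro fundamental_theorem_of_calculus)
       (auto intro!: derivative_eq_intros simp flip: has_real_derivative_iff_has_vector_derivative)
  then show ?thesis by simp
qed

lemma borel_measurable_cnj [measurable]: "f \<in> borel_measurable M \<Longrightarrow> (\<lambda>x. cnj (f x)) \<in> borel_measurable M"
  by (rule measurable_compose[OF _ borel_measurable_continuous_onI]) (auto intro: continuous_intros)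

text \<open>Completing the square in each coefficient; each \<open>e l\<close> has squared norm
  \<open>V\<close> because it is unimodular. The choice \<open>c l = a l / V\<close> removes the
  last sum and gives Bessel's inequality. For any other \<open>c\<close> the last sum is
  nonnegative, so a good approximation forces the sum of the squared coefficients \<open>a l\<close>
  to be large.\<close>

lemma orthogonal_expansion:
  fixes e :: "'i \<Rightarrow> 'b \<Rightarrow> complex"
  assumes "finite_measure M" "finite F"
    and e: "\<And>l. l \<in> F \<Longrightarrow> e l \<in> borel_measurable M" "\<And>l x. cmod (e l x) = 1"
    and orth: "\<And>l l'. l \<in> F \<Longrightarrow> l' \<in> F \<Longrightarrow> l \<noteq> l' \<Longrightarrow> (LINT x|M. e l x * cnj (e l' x)) = 0"
    and f: "f \<in> borel_measurable M" "\<And>x. cmod (f x) \<le> K"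
    and V: "V = measure M (space M)" "V > 0"
  defines "a \<equiv> \<lambda>l. LINT x|M. f x * cnj (e l x)"
  shows "(LINT x|M. (cmod (f x - (\<Sum>l\<in>F. c l * e l x)))\<^sup>2) =
      (LINT x|M. (cmod (f x))\<^sup>2) - (\<Sum>l\<in>F. (cmod (a l))\<^sup>2) / V + V * (\<Sum>l\<in>F. (cmod (c l - a l / V))\<^sup>2)"
proof -
  interpret finite_measure M by fact
  have int: "integrable M g" if "g \<in> borel_measurable M" "\<And>x. cmod (g x) \<le> C" for g :: "'b \<Rightarrow> complex" and C
    using that by (intro integrable_const_bound[of _ C]) auto
  have K: "K \<ge> 0" using f(2) norm_ge_zero order_trans by blast
  have i1: "integrable M (\<lambda>x. f x * cnj (e l x))" if "l \<in> F" for l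
    using that e f by (intro int[where C = K]) (auto simp: norm_mult)
  have i2: "integrable M (\<lambda>x. e l x * cnj (f x))" if "l \<in> F" for l
    using that e f by (intro int[where C = K]) (auto simp: norm_mult)
  have i3: "integrable M (\<lambda>x. e l x * cnj (e l' x))" if "l \<in> F" "l' \<in> F" for l l'
    using that e by (intro int[where C = 1]) (auto simp: norm_mult)
  have i4: "integrable M (\<lambda>x. f x * cnj (f x))"
    using f K by (intro int[where C = "K * K"]) (auto simp: norm_mult intro: mult_mono)
  have ee: "(LINT x|M. e l x * cnj (e l' x)) = (if l = l' then V else 0)" if "l \<in> F" "l' \<in> F" for l l'
  proof (cases "l = l'")
    case True
    then have "(LINT x|M. e l x * cnj (e l' x)) = (LINT x|M. 1)"
      using e(2) by (intro Bochner_Integration.integral_cong) (auto simp: complex_norm_square[symmetric])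
    with True show ?thesis by (simp add: V scaleR_conv_of_real)
  qed (use orth that in auto)
  have a_cnj: "(LINT x|M. e l x * cnj (f x)) = cnj (a l)" for l
    unfolding a_def by (subst Bochner_Integration.integral_cnj[symmetric]) (simp add: mult.commute)
  have "complex_of_real (LINT x|M. (cmod (f x - (\<Sum>l\<in>F. c l * e l x)))\<^sup>2) =
      (LINT x|M. (f x - (\<Sum>l\<in>F. c l * e l x)) * cnj (f x - (\<Sum>l\<in>F. c l * e l x)))"
    by (simp only: integral_complex_of_real[symmetric] complex_norm_square)
  also have "\<dots> = (LINT x|M. f x * cnj (f x) - (\<Sum>l\<in>F. cnj (c l) * (f x * cnj (e l x)))
      - (\<Sum>l\<in>F. c l * (e l x * cnj (f x)))
      + (\<Sum>l\<in>F. \<Sum>l'\<in>F. c l * cnj (c l') * (e l x * cnj (e l' x))))"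
    by (intro Bochner_Integration.integral_cong refl)
       (simp add: algebra_simps sum_distrib_left sum_distrib_right sum_product, rule sum.swap)
  also have "\<dots> = (LINT x|M. f x * cnj (f x)) - (\<Sum>l\<in>F. cnj (c l) * a l) - (\<Sum>l\<in>F. c l * cnj (a l))
      + (\<Sum>l\<in>F. \<Sum>l'\<in>F. c l * cnj (c l') * (if l = l' then V else 0))"
    using i1 i2 i3 i4 by (simp add: Bochner_Integration.integral_sum ee a_cnj cong: sum.cong) (simp add: a_def)
  also have "(LINT x|M. f x * cnj (f x)) = complex_of_real (LINT x|M. (cmod (f x))\<^sup>2)"
    by (simp only: integral_complex_of_real[symmetric] complex_norm_square)
  also have "(\<Sum>l\<in>F. \<Sum>l'\<in>F. c l * cnj (c l') * complex_of_real (if l = l' then V else 0)) = (\<Sum>l\<in>F. V * (c l * cnj (c l)))"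
    using \<open>finite F\<close> by (intro sum.cong) (auto simp: if_distrib cong: if_cong)
  also have "complex_of_real (LINT x|M. (cmod (f x))\<^sup>2) - (\<Sum>l\<in>F. cnj (c l) * a l) - (\<Sum>l\<in>F. c l * cnj (a l))
      + (\<Sum>l\<in>F. V * (c l * cnj (c l))) =
      complex_of_real (LINT x|M. (cmod (f x))\<^sup>2)
      + (\<Sum>l\<in>F. V * (c l * cnj (c l)) - cnj (c l) * a l - c l * cnj (a l))"
    by (simp add: sum.distrib sum_subtractf)
  also have "(\<Sum>l\<in>F. V * (c l * cnj (c l)) - cnj (c l) * a l - c l * cnj (a l)) =
      (\<Sum>l\<in>F. V * ((c l - a l / V) * cnj (c l - a l / V)) - a l * cnj (a l) / V)"
    using V(2) by (intro sum.cong) (auto simp: field_simps)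
  also have "\<dots> = complex_of_real (\<Sum>l\<in>F. V * (cmod (c l - a l / V))\<^sup>2 - (cmod (a l))\<^sup>2 / V)"
    by (simp only: of_real_sum of_real_diff of_real_mult of_real_divide complex_norm_square)
  finally have "(LINT x|M. (cmod (f x - (\<Sum>l\<in>F. c l * e l x)))\<^sup>2) =
     (LINT x|M. (cmod (f x))\<^sup>2) + (\<Sum>l\<in>F. V * (cmod (c l - a l / V))\<^sup>2 - (cmod (a l))\<^sup>2 / V)"
    by (simp only: of_real_add[symmetric] of_real_eq_iff)
  then show ?thesis
    by (simp add: sum_subtractf sum_distrib_left sum_divide_distrib)
qed

section \<open>Sums over unions and sequences of polynomial growth\<close>

lemma sum_UN_le:
  fixes f :: "'b \<Rightarrow> real"
  assumes "finite I" "\<And>i. i \<in> I \<Longrightarrow> finite (A i)" "\<And>x. f x \<ge> 0"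
  shows "sum f (\<Union>i\<in>I. A i) \<le> (\<Sum>i\<in>I. sum f (A i))"
  using assms(1,2)
proof (induction I rule: finite_induct)
  case (insert i I)
  have "sum f (A i \<union> (\<Union>i\<in>I. A i)) \<le> sum f (A i) + sum f (\<Union>i\<in>I. A i)"
    using sum.union_inter[of "A i" "\<Union>i\<in>I. A i" f] insert
      sum_nonneg[of "A i \<inter> (\<Union>i\<in>I. A i)" f] assms(3) by simp
  with insert show ?case by simp
qed simp

text \<open>If every step multiplied \<open>N\<close> by at least \<open>1 + \<kappa>\<close>, then
  \<open>N n\<close> would outgrow every polynomial. It is applied to the number of points of the
  spectrum in growing balls.\<close>

lemma slow_growth_step:
  fixes N :: "nat \<Rightarrow> real"
  assumes "N 0 > 0" "\<kappa> > 0" "\<And>n. N n \<le> (a + b * real n) ^ d" "a \<ge> 0" "b \<ge> 0" "d > 0"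
  obtains n where "N (Suc n) \<le> (1 + \<kappa>) * N n"
proof (rule ccontr)
  assume "\<not> thesis"
  with that have step: "N (Suc n) \<ge> (1 + \<kappa>) * N n" for n
    by (meson linear not_le)
  have ge: "N n \<ge> (1 + \<kappa>) ^ n * N 0" for n
  proof (induction n)
    case (Suc n)
    have "(1 + \<kappa>) ^ Suc n * N 0 \<le> (1 + \<kappa>) * N n"
      using Suc assms(2) by (simp add: mult.assoc)
    also have "\<dots> \<le> N (Suc n)" by (rule step)
    finally show ?case .
  qed simp
  define c where "c = 1 / (1 + \<kappa>)"
  have c: "0 < c" "c < 1" using assms(2) by (auto simp: c_def)
  \<comment> \<open>The root turns \<open>n ^ d * c ^ n\<close> into the \<open>d\<close>-th power
    of \<open>n * q ^ n\<close>, which tends to 0 because |q| < 1.\<close>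
  define q where "q = root d c"
  have q: "q ^ d = c" "\<bar>q\<bar> < 1"
    using c \<open>d > 0\<close> by (auto simp: q_def real_root_ge_zero)
  have "(\<lambda>n. (real n * q ^ n) ^ d) \<longlonglongrightarrow> 0 ^ d"
    using q(2) by (intro tendsto_power powser_times_n_limit_0) simp
  then have "(\<lambda>n. real n ^ d * c ^ n) \<longlonglongrightarrow> 0"
    using \<open>d > 0\<close> by (simp add: power_mult_distrib zero_power mult.commute flip: q(1) power_mult)
  then have "(\<lambda>n. (a + b) ^ d * (real n ^ d * c ^ n)) \<longlonglongrightarrow> (a + b) ^ d * 0"
    by (intro tendsto_mult tendsto_const)
  moreover have "\<forall>\<^sub>F n in sequentially. N 0 \<le> (a + b) ^ d * (real n ^ d * c ^ n)"
    using eventually_ge_at_top[of 1]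
  proof eventually_elim
    case (elim n)
    have "a + b * real n \<le> (a + b) * real n"
      using elim assms(4,5) mult_left_mono[of 1 "real n" a] by (simp add: algebra_simps)
    then have "(1 + \<kappa>) ^ n * N 0 \<le> ((a + b) * real n) ^ d"
      using assms(4,5) by (intro order_trans[OF ge] order_trans[OF assms(3)] power_mono) auto
    then show ?case
      using assms(2) by (simp add: c_def power_mult_distrib[symmetric] power_divide pos_le_divide_eq mult.commute)
  qed
  ultimately have "N 0 \<le> (a + b) ^ d * 0"
    by (intro tendsto_lowerbound) auto
  with assms(1) show False by simp
qed

section \<open>Sets with a spectrum\<close>

text \<open>A Borel set with its spectrum, reduced to facts about \<open>ft\<close>: the number
  \<open>ft A (\<xi> - l)\<close> is the coefficient, against the exponential \<open>l\<close>, of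
  the indicator of \<open>A\<close> times the exponential \<xi>. Bessel's inequality is stated for
  the difference of two sets because it will be applied to a set and its translate; the other half
  of Parseval's identity is a lower bound by finite sums.\<close>

locale spectral_pair =
  fixes S L :: "'a::euclidean_space set"
  assumes S_borel [measurable]: "S \<in> sets borel" and bounded_S: "bounded S"
    and S_pos: "measure lborel S > 0"
    and orthogonal: "l \<in> L \<Longrightarrow> l' \<in> L \<Longrightarrow> l \<noteq> l' \<Longrightarrow> ft S (l - l') = 0"
    and bessel: "A \<in> sets borel \<Longrightarrow> A \<subseteq> S \<Longrightarrow> A' \<in> sets borel \<Longrightarrow> A' \<subseteq> S \<Longrightarrow> finite F \<Longrightarrow> F \<subseteq> L \<Longrightarrow>
      (\<Sum>l\<in>F. (cmod (ft A (\<xi> - l) - ft A' (\<xi> - l)))\<^sup>2)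
        \<le> measure lborel S * measure lborel ((A - A') \<union> (A' - A))"
    and parseval: "A \<in> sets borel \<Longrightarrow> A \<subseteq> S \<Longrightarrow> \<epsilon> > 0 \<Longrightarrow>
      \<exists>F. finite F \<and> F \<subseteq> L \<and> measure lborel S * measure lborel A - \<epsilon> \<le> (\<Sum>l\<in>F. (cmod (ft A (\<xi> - l)))\<^sup>2)"
begin

section \<open>Uniform decay of the Fourier coefficients\<close>

lemma fmeasurable_subset: "A \<in> sets borel \<Longrightarrow> A \<subseteq> S \<Longrightarrow> A \<in> fmeasurable lborel"
  using bounded_borel_fmeasurable bounded_subset[OF bounded_S] by blast

text \<open>Subtracting from an indicator its translate by \<open>a\<close> multiplies the transform
  by \<open>1 - exponential (\<xi> - l) a\<close>, so Bessel's inequality bounds the sum by the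
  measure of a symmetric difference. Both sets have to lie in \<open>S\<close> for this, hence the
  detour through \<open>A1\<close>.\<close>

lemma bessel_modulated:
  assumes [measurable]: "A \<in> sets borel" and "A \<subseteq> S" and F: "finite F" "F \<subseteq> L"
    and \<epsilon>: "measure lborel (A - {x. x - a \<in> A}) \<le> \<epsilon>" "measure lborel (A - {x. x - (- a) \<in> A}) \<le> \<epsilon>"
  shows "(\<Sum>l\<in>F. (cmod (ft A (\<xi> - l)))\<^sup>2 * (cmod (1 - exponential (\<xi> - l) a))\<^sup>2)
    \<le> 12 * measure lborel S * \<epsilon>"
proof -
  \<comment> \<open>\<open>A1\<close> is the part of \<open>A\<close> that stays inside
    \<open>S\<close> when moved by \<open>a\<close>, and \<open>A2\<close> is its translate. A point
    of \<open>A\<close> that moves to a point of \<open>A\<close> belongs to \<open>A1\<close>, so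
    little of \<open>A\<close> is lost.\<close>
  define A1 A2 where "A1 = A \<inter> {x. x + a \<in> S}" and "A2 = {x. x - a \<in> A1}"
  have [measurable]: "A1 \<in> sets borel" "A2 \<in> sets borel"
    unfolding A1_def A2_def by measurable
  have sub: "A1 \<subseteq> S" "A2 \<subseteq> S" using \<open>A \<subseteq> S\<close> by (auto simp: A1_def A2_def)
  have sub1: "A1 \<subseteq> A" by (auto simp: A1_def)
  have fA: "A \<in> fmeasurable lborel" "A1 \<in> fmeasurable lborel" "A2 \<in> fmeasurable lborel"
    using fmeasurable_subset \<open>A \<subseteq> S\<close> sub by auto
  have d1: "measure lborel (A - A1) \<le> \<epsilon>"
  proof (rule order_trans[OF _ \<epsilon>(2)])
    show "measure lborel (A - A1) \<le> measure lborel (A - {x. x - - a \<in> A})"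
      using fA \<open>A \<subseteq> S\<close> by (intro measure_mono_fmeasurable fmeasurable_Diff) (auto simp: A1_def)
  qed
  have d2: "measure lborel (A1 - A2) \<le> \<epsilon>"
  proof (rule order_trans[OF _ \<epsilon>(1)])
    have "A1 - A2 \<subseteq> A - {x. x - a \<in> A}"
      using \<open>A \<subseteq> S\<close> by (auto simp: A1_def A2_def)
    then show "measure lborel (A1 - A2) \<le> measure lborel (A - {x. x - a \<in> A})"
      using fA by (intro measure_mono_fmeasurable fmeasurable_Diff) auto
  qed
  \<comment> \<open>Translation preserves measure, so \<open>A2 - A1\<close> is as large as
    \<open>A1 - A2\<close>.\<close>
  have "measure lborel (A2 - A1) = measure lborel A2 - measure lborel (A1 \<inter> A2)"
    using measure_Diff[of lborel A2 "A1 \<inter> A2"] fA by (auto simp: fmeasurable_def Diff_Int)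
  also have "measure lborel A2 = measure lborel A1"
    unfolding A2_def by (rule measure_translate) simp
  also have "\<dots> - measure lborel (A1 \<inter> A2) = measure lborel (A1 - A2)"
    using measure_Diff[of lborel A1 "A1 \<inter> A2"] fA by (auto simp: fmeasurable_def Diff_Int)
  finally have d3: "measure lborel (A2 - A1) \<le> \<epsilon>" using d2 by simp
  \<comment> \<open>With \<open>z\<close>, \<open>w\<close> the transforms of \<open>A\<close>,
    \<open>A1\<close> and \<open>u\<close> the exponential at \<open>a\<close>,
    \<open>z * (1 - u) = (w - u * w) + (z - w) * (1 - u)\<close> and |1 - u| <= 2; then (p + 2q)^2
    <= 2p^2 + 8q^2. The two parts cost 2 times 2 and 8 times
    \<open>measure lborel S * \<epsilon>\<close>, together the factor 12.\<close>
  have "(\<Sum>l\<in>F. (cmod (ft A (\<xi> - l)))\<^sup>2 * (cmod (1 - exponential (\<xi> - l) a))\<^sup>2) \<le>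
     (\<Sum>l\<in>F. 2 * (cmod (ft A1 (\<xi> - l) - ft A2 (\<xi> - l)))\<^sup>2 + 8 * (cmod (ft A (\<xi> - l) - ft A1 (\<xi> - l)))\<^sup>2)"
  proof (rule sum_mono)
    fix l assume "l \<in> F"
    define z w u where "z = ft A (\<xi> - l)" and "w = ft A1 (\<xi> - l)" and "u = exponential (\<xi> - l) a"
    have A2: "ft A2 (\<xi> - l) = u * w"
      unfolding A2_def w_def u_def by (rule ft_translate) simp
    have "cmod (1 - u) \<le> 2"
      using norm_triangle_ineq4[of 1 u] by (simp add: u_def)
    have "cmod (z * (1 - u)) = cmod ((w - u * w) + (z - w) * (1 - u))"
      by (simp add: algebra_simps)
    also have "\<dots> \<le> cmod (w - u * w) + cmod (z - w) * 2"
      using \<open>cmod (1 - u) \<le> 2\<close>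
      by (intro order_trans[OF norm_triangle_ineq] add_left_mono) (auto simp: norm_mult intro: mult_left_mono)
    finally have "(cmod (z * (1 - u)))\<^sup>2 \<le> (cmod (w - u * w) + cmod (z - w) * 2)\<^sup>2"
      by (intro power_mono) auto
    also have "\<dots> \<le> 2 * (cmod (w - u * w))\<^sup>2 + 8 * (cmod (z - w))\<^sup>2"
      using zero_le_power2[of "cmod (w - u * w) - cmod (z - w) * 2"]
      by (simp add: power2_eq_square algebra_simps)
    finally show "(cmod (ft A (\<xi> - l)))\<^sup>2 * (cmod (1 - exponential (\<xi> - l) a))\<^sup>2 \<le>
        2 * (cmod (ft A1 (\<xi> - l) - ft A2 (\<xi> - l)))\<^sup>2 + 8 * (cmod (ft A (\<xi> - l) - ft A1 (\<xi> - l)))\<^sup>2"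
      by (simp add: A2 norm_mult power_mult_distrib flip: z_def w_def u_def)
  qed
  also have "\<dots> = 2 * (\<Sum>l\<in>F. (cmod (ft A1 (\<xi> - l) - ft A2 (\<xi> - l)))\<^sup>2)
      + 8 * (\<Sum>l\<in>F. (cmod (ft A (\<xi> - l) - ft A1 (\<xi> - l)))\<^sup>2)"
    by (simp add: sum.distrib sum_distrib_left)
  also have "\<dots> \<le> 2 * (measure lborel S * measure lborel ((A1 - A2) \<union> (A2 - A1)))
      + 8 * (measure lborel S * measure lborel ((A - A1) \<union> (A1 - A)))"
    using bessel[OF _ sub(1) _ sub(2) F] bessel[OF _ \<open>A \<subseteq> S\<close> _ sub(1) F]
    by (intro add_mono mult_left_mono) auto
  also have "\<dots> \<le> 2 * (measure lborel S * (\<epsilon> + \<epsilon>)) + 8 * (measure lborel S * \<epsilon>)"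
  proof (intro add_mono mult_left_mono)
    have "measure lborel ((A1 - A2) \<union> (A2 - A1)) \<le> measure lborel (A1 - A2) + measure lborel (A2 - A1)"
      by (intro measure_Un_le) auto
    then show "measure lborel ((A1 - A2) \<union> (A2 - A1)) \<le> \<epsilon> + \<epsilon>" using d2 d3 by linarith
    have "(A - A1) \<union> (A1 - A) = A - A1" using sub1 by auto
    then show "measure lborel ((A - A1) \<union> (A1 - A)) \<le> \<epsilon>" using d1 by simp
  qed auto
  finally show ?thesis by (simp add: algebra_simps)
qed

text \<open>
  The bound is obtained by integrating the previous one over \<open>a = s *\<^sub>R b\<close> with \<open>0 \<le> s \<le> \<eta>\<close>: the
  mean of \<open>\<bar>1 - e(s t)\<bar>\<^sup>2\<close> is at least \<open>1\<close> as soon as \<open>\<bar>t\<bar> \<ge> 1 / (\<pi> \<eta>)\<close>.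
\<close>

lemma tail_coordinate:
  assumes A [measurable]: "A \<in> sets borel" "A \<subseteq> S" and F: "finite F" "F \<subseteq> L" and b: "b \<in> Basis"
    and "\<eta> > 0" and \<eta>: "\<And>a. norm a \<le> \<eta> \<Longrightarrow> measure lborel (A - {x. x - a \<in> A}) \<le> \<epsilon>"
  shows "(\<Sum>l\<in>{l\<in>F. \<bar>(\<xi> - l) \<bullet> b\<bar> \<ge> 1 / (pi * \<eta>)}. (cmod (ft A (\<xi> - l)))\<^sup>2)
    \<le> 12 * measure lborel S * \<epsilon>"
proof -
  define G where "G = {l\<in>F. \<bar>(\<xi> - l) \<bullet> b\<bar> \<ge> 1 / (pi * \<eta>)}"
  define w where "w l = (cmod (ft A (\<xi> - l)))\<^sup>2" for l
  define k where "k l = 2 * pi * ((\<xi> - l) \<bullet> b)" for l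
  have G: "finite G" "G \<subseteq> L" using F by (auto simp: G_def)
  \<comment> \<open>In terms of \<open>k\<close> the threshold reads |k| >= 2 / \<eta>, exactly what
    bounds the oscillating term \<open>2 * sin (\<eta> * k l) / k l\<close> by \<eta>.\<close>
  have k: "\<bar>k l\<bar> \<ge> 2 / \<eta>" if "l \<in> G" for l
    using that \<open>\<eta> > 0\<close> by (auto simp: G_def k_def abs_mult field_simps)
  have k0: "k l \<noteq> 0" if "l \<in> G" for l
    using k[OF that] \<open>\<eta> > 0\<close> by (auto simp: field_simps)
  have int: "((\<lambda>s. \<Sum>l\<in>G. w l * (2 - 2 * cos (s * k l))) has_integral
      (\<Sum>l\<in>G. w l * (2 * \<eta> - 2 * sin (\<eta> * k l) / k l))) {0..\<eta>}"
    using \<open>\<eta> > 0\<close> k0 G(1)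
    by (intro has_integral_sum has_integral_mult_right integral_one_minus_cos) auto
  have "\<eta> * (\<Sum>l\<in>G. w l) = (\<Sum>l\<in>G. w l * \<eta>)"
    by (simp add: sum_distrib_left mult.commute)
  also have "\<dots> \<le> (\<Sum>l\<in>G. w l * (2 * \<eta> - 2 * sin (\<eta> * k l) / k l))"
  proof (intro sum_mono mult_left_mono)
    fix l assume l: "l \<in> G"
    have "2 * sin (\<eta> * k l) / k l \<le> \<bar>2 * sin (\<eta> * k l) / k l\<bar>" by (rule abs_ge_self)
    also have "\<dots> \<le> 2 / \<bar>k l\<bar>"
      by (auto simp: abs_mult intro!: divide_right_mono)
    also have "\<dots> \<le> \<eta>"
      using k[OF l] k0[OF l] \<open>\<eta> > 0\<close> by (simp add: field_simps)
    finally show "\<eta> \<le> 2 * \<eta> - 2 * sin (\<eta> * k l) / k l" by simp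
  qed (auto simp: w_def)
  also have "\<dots> \<le> 12 * measure lborel S * \<epsilon> * (\<eta> - 0)"
  proof (rule has_integral_le[OF int])
    show "((\<lambda>s. 12 * measure lborel S * \<epsilon>) has_integral 12 * measure lborel S * \<epsilon> * (\<eta> - 0)) {0..\<eta>}"
      using has_integral_const_real[of "12 * measure lborel S * \<epsilon>" 0 \<eta>] \<open>\<eta> > 0\<close>
      by (simp add: mult.commute)
    fix s assume "s \<in> {0..\<eta>}"
    then have s: "norm (s *\<^sub>R b) \<le> \<eta>" using b by simp
    have "(\<Sum>l\<in>G. w l * (2 - 2 * cos (s * k l))) =
       (\<Sum>l\<in>G. (cmod (ft A (\<xi> - l)))\<^sup>2 * (cmod (1 - exponential (\<xi> - l) (s *\<^sub>R b)))\<^sup>2)"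
      by (simp add: w_def k_def exponential_cis norm_one_minus_cis mult_ac)
    also have "\<dots> \<le> 12 * measure lborel S * \<epsilon>"
      using \<eta>[of "s *\<^sub>R b"] \<eta>[of "- (s *\<^sub>R b)"] s by (intro bessel_modulated A G) auto
    finally show "(\<Sum>l\<in>G. w l * (2 - 2 * cos (s * k l))) \<le> 12 * measure lborel S * \<epsilon>" .
  qed
  finally show ?thesis
    using \<open>\<eta> > 0\<close> by (simp add: w_def G_def mult.commute)
qed

text \<open>A vector of norm at least \<open>D * q\<close> has a coordinate of size at least
  \<open>q\<close>, and the tails in the \<open>D\<close> coordinate directions add up. The point is
  that \<open>r\<close> depends neither on the centre \<xi> nor on \<open>F\<close>.\<close>

lemma uniform_tail:
  assumes A [measurable]: "A \<in> sets borel" "A \<subseteq> S" and "\<epsilon> > 0"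
  obtains r where "r > 0"
    "\<And>\<xi> F. finite F \<Longrightarrow> F \<subseteq> L \<Longrightarrow> (\<Sum>l\<in>{l\<in>F. norm (\<xi> - l) \<ge> r}. (cmod (ft A (\<xi> - l)))\<^sup>2) \<le> \<epsilon>"
proof -
  define D where "D = real DIM('a)"
  have "D > 0" by (simp add: D_def)
  define \<delta> where "\<delta> = \<epsilon> / (D * 12 * measure lborel S)"
  have "\<delta> > 0" using \<open>\<epsilon> > 0\<close> S_pos \<open>D > 0\<close> by (simp add: \<delta>_def)
  obtain \<eta> where \<eta>: "\<eta> > 0" "\<And>a. norm a \<le> \<eta> \<Longrightarrow> measure lborel (A - {x. x - a \<in> A}) \<le> \<delta>"
    using translation_continuity[OF A(1) bounded_subset[OF bounded_S A(2)] \<open>\<delta> > 0\<close>] by metis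
  define q where "q = 1 / (pi * \<eta>)"
  have "q > 0" using \<eta> by (simp add: q_def)
  show thesis
  proof
    show "D * q > 0" using \<open>q > 0\<close> \<open>D > 0\<close> by simp
    fix \<xi> :: 'a and F assume F: "finite F" "F \<subseteq> L"
    have cover: "{l\<in>F. norm (\<xi> - l) \<ge> D * q} \<subseteq> (\<Union>b\<in>Basis. {l\<in>F. \<bar>(\<xi> - l) \<bullet> b\<bar> \<ge> q})"
    proof safe
      fix l assume l: "l \<in> F" "norm (\<xi> - l) \<ge> D * q"
      have "\<exists>b\<in>Basis. \<bar>(\<xi> - l) \<bullet> b\<bar> \<ge> q"
      proof (rule ccontr)
        assume "\<not> ?thesis"
        then have "(\<Sum>b\<in>Basis. \<bar>(\<xi> - l) \<bullet> b\<bar>) < (\<Sum>b\<in>(Basis::'a set). q)"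
          by (intro sum_strict_mono) (auto simp: not_le)
        with norm_le_l1[of "\<xi> - l"] l show False by (simp add: D_def)
      qed
      with l show "l \<in> (\<Union>b\<in>Basis. {l\<in>F. \<bar>(\<xi> - l) \<bullet> b\<bar> \<ge> q})" by auto
    qed
    have "(\<Sum>l\<in>{l\<in>F. norm (\<xi> - l) \<ge> D * q}. (cmod (ft A (\<xi> - l)))\<^sup>2) \<le>
        (\<Sum>l\<in>(\<Union>b\<in>Basis. {l\<in>F. \<bar>(\<xi> - l) \<bullet> b\<bar> \<ge> q}). (cmod (ft A (\<xi> - l)))\<^sup>2)"
      using F by (intro sum_mono2 cover) auto
    also have "\<dots> \<le> (\<Sum>b\<in>Basis. \<Sum>l\<in>{l\<in>F. \<bar>(\<xi> - l) \<bullet> b\<bar> \<ge> q}. (cmod (ft A (\<xi> - l)))\<^sup>2)"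
      using F by (intro sum_UN_le) auto
    also have "\<dots> \<le> (\<Sum>b\<in>(Basis::'a set). 12 * measure lborel S * \<delta>)"
      unfolding q_def using F \<eta> by (intro sum_mono tail_coordinate A) auto
    also have "\<dots> = \<epsilon>"
      using S_pos \<open>D > 0\<close> by (simp add: \<delta>_def D_def)
    finally show "(\<Sum>l\<in>{l\<in>F. norm (\<xi> - l) \<ge> D * q}. (cmod (ft A (\<xi> - l)))\<^sup>2) \<le> \<epsilon>" .
  qed
qed

section \<open>Separation, growth and concentration of the spectrum\<close>

text \<open>Orthogonality makes \<open>ft S\<close> vanish at \<open>l - l'\<close>, whereas near
  the origin it is close to the positive number \<open>measure lborel S\<close>.\<close>

lemma separation:
  obtains \<rho> where "\<rho> > 0" "\<And>l l'. l \<in> L \<Longrightarrow> l' \<in> L \<Longrightarrow> l \<noteq> l' \<Longrightarrow> \<rho> \<le> dist l l'"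
proof -
  obtain M where M: "M > 0" "\<And>x. x \<in> S \<Longrightarrow> norm x \<le> M"
    using bounded_S by (auto simp: bounded_pos)
  have fS: "S \<in> fmeasurable lborel" by (intro fmeasurable_subset) auto
  show thesis
  proof
    show "1 / (2 * pi * M) > 0" using M by simp
    fix l l' assume l: "l \<in> L" "l' \<in> L" "l \<noteq> l'"
    have "measure lborel S \<le> 2 * pi * M * norm (l - l') * measure lborel S"
      using norm_ft_diff_le[OF fS M(2), of "l - l'"] orthogonal[OF l] by simp
    then have "1 \<le> 2 * pi * M * norm (l - l')" using S_pos by simp
    then show "1 / (2 * pi * M) \<le> dist l l'"
      using M by (simp add: dist_norm field_simps)
  qed
qed

text \<open>A packing argument: the balls of radius \<open>\<rho> / 2\<close> about the points are
  disjoint and lie in the ball of radius \<open>R + \<rho> / 2\<close>, so their number is at most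
  the ratio of the volumes.\<close>

lemma polynomial_growth:
  "\<exists>C\<ge>0. \<forall>R\<ge>0. finite {l\<in>L. norm l \<le> R} \<and> real (card {l\<in>L. norm l \<le> R}) \<le> (1 + C * R) ^ DIM('a)"
proof -
  obtain \<rho> where \<rho>: "\<rho> > 0" "\<And>l l'. l \<in> L \<Longrightarrow> l' \<in> L \<Longrightarrow> l \<noteq> l' \<Longrightarrow> \<rho> \<le> dist l l'"
    by (rule separation) blast
  define u where "u = unit_ball_vol (real DIM('a))"
  have u: "u > 0" by (simp add: u_def)
  have card: "real (card F) \<le> (1 + 2 / \<rho> * R) ^ DIM('a)"
    if F: "finite F" "F \<subseteq> L" "\<And>l. l \<in> F \<Longrightarrow> norm l \<le> R" and "R \<ge> 0" for F R
  proof -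
    have "real (card F) * (u * (\<rho> / 2) ^ DIM('a)) = (\<Sum>l\<in>F. measure lborel (ball l (\<rho> / 2)))"
      using \<rho> by (simp add: content_ball u_def)
    also have "\<dots> = measure lborel (\<Union>l\<in>F. ball l (\<rho> / 2))"
    proof (rule measure_finite_Union[symmetric])
      show "disjoint_family_on (\<lambda>l. ball l (\<rho> / 2)) F"
        unfolding disjoint_family_on_def
      proof (intro ballI impI)
        fix l l' assume "l \<in> F" "l' \<in> F" "l \<noteq> l'"
        then have "\<rho> \<le> dist l l'" using F(2) by (intro \<rho>(2)) auto
        then show "ball l (\<rho> / 2) \<inter> ball l' (\<rho> / 2) = {}"
          by (intro disjoint_ballI) simp
      qed
      show "emeasure lborel (ball l (\<rho> / 2)) \<noteq> \<infinity>" for l :: 'a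
        by (rule less_imp_neq[OF emeasure_lborel_ball_finite])
    qed (use F in auto)
    also have "\<dots> \<le> measure lborel (ball 0 (R + \<rho> / 2) :: 'a set)"
    proof (intro measure_mono_fmeasurable)
      show "(\<Union>l\<in>F. ball l (\<rho> / 2)) \<subseteq> ball 0 (R + \<rho> / 2)"
      proof safe
        fix l x assume "l \<in> F" "x \<in> ball l (\<rho> / 2)"
        then show "x \<in> ball 0 (R + \<rho> / 2)"
          using F(3)[of l] norm_triangle_sub[of x l] by (auto simp: dist_norm norm_minus_commute)
      qed
    qed (auto intro!: bounded_borel_fmeasurable borel_open)
    also have "\<dots> = u * (R + \<rho> / 2) ^ DIM('a)"
      using \<rho> \<open>R \<ge> 0\<close> by (simp add: content_ball u_def)
    also have "R + \<rho> / 2 = (1 + 2 / \<rho> * R) * (\<rho> / 2)"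
      using \<rho> by (simp add: field_simps)
    finally have "real (card F) * (u * (\<rho> / 2) ^ DIM('a)) \<le>
        (1 + 2 / \<rho> * R) ^ DIM('a) * (u * (\<rho> / 2) ^ DIM('a))"
      by (simp only: power_mult_distrib mult_ac)
    moreover have "u * (\<rho> / 2) ^ DIM('a) > 0" using u \<rho> by simp
    ultimately show ?thesis by (rule mult_right_le_imp_le)
  qed
  \<comment> \<open>Finiteness follows from the same count: an infinite set would contain a finite
    subset with more points than the bound allows.\<close>
  have "finite {l\<in>L. norm l \<le> R}" if "R \<ge> 0" for R
  proof (rule ccontr)
    assume "infinite {l\<in>L. norm l \<le> R}"
    then obtain G where G: "G \<subseteq> {l\<in>L. norm l \<le> R}" "finite G"
        "card G = Suc (nat \<lfloor>(1 + 2 / \<rho> * R) ^ DIM('a)\<rfloor>)"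
      using infinite_arbitrarily_large by blast
    have "real (card G) \<le> (1 + 2 / \<rho> * R) ^ DIM('a)"
      using G \<open>R \<ge> 0\<close> by (intro card) auto
    with G(3) show False by linarith
  qed
  then show ?thesis
    using \<rho>(1) by (intro exI[of _ "2 / \<rho>"] conjI allI impI card) auto
qed

text \<open>Up to \<open>\<epsilon> / 2\<close>, Parseval's identity centred at \<open>l\<close>
  involves only the \<open>l'\<close> within distance \<rho> of \<open>l\<close>. If
  \<open>l\<close> runs through a ball, these lie in the ball with radius larger by \<rho>.
  Polynomial growth provides a radius at which this enlargement adds relatively few points, so the
  outer shell hardly counts. One \<open>F\<close> serves all sets of the finite family.\<close>

lemma concentration:
  assumes "finite \<A>" and \<A>: "\<And>A. A \<in> \<A> \<Longrightarrow> A \<in> sets borel" "\<And>A. A \<in> \<A> \<Longrightarrow> A \<subseteq> S" and "\<epsilon> > 0"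
  obtains F where "finite F" "F \<subseteq> L" "F \<noteq> {}"
    "\<And>A. A \<in> \<A> \<Longrightarrow> real (card F) * (measure lborel S * measure lborel A - \<epsilon>)
      \<le> (\<Sum>l\<in>F. \<Sum>l'\<in>F. (cmod (ft A (l - l')))\<^sup>2)"
proof -
  define V where "V = measure lborel S"
  have V: "V > 0" using S_pos by (simp add: V_def)
  define T where "T A r \<longleftrightarrow> r > 0 \<and> (\<forall>\<xi> F. finite F \<longrightarrow> F \<subseteq> L \<longrightarrow>
      (\<Sum>l\<in>{l\<in>F. norm (\<xi> - l) \<ge> r}. (cmod (ft A (\<xi> - l)))\<^sup>2) \<le> \<epsilon> / 4)" for A r
  have "\<exists>r. T A r" if "A \<in> \<A>" for A
  proof (rule uniform_tail[OF \<A>(1)[OF that] \<A>(2)[OF that]])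
    show "\<epsilon> / 4 > 0" using \<open>\<epsilon> > 0\<close> by simp
  qed (auto simp: T_def)
  then obtain r where T: "\<And>A. A \<in> \<A> \<Longrightarrow> T A (r A)" by metis
  then have r: "\<And>A. A \<in> \<A> \<Longrightarrow> r A > 0"
    "\<And>A \<xi> F. A \<in> \<A> \<Longrightarrow> finite F \<Longrightarrow> F \<subseteq> L \<Longrightarrow>
      (\<Sum>l\<in>{l\<in>F. norm (\<xi> - l) \<ge> r A}. (cmod (ft A (\<xi> - l)))\<^sup>2) \<le> \<epsilon> / 4"
    by (auto simp: T_def)
  \<comment> \<open>Larger than every tail radius, and positive even for an empty family.\<close>
  define \<rho> where "\<rho> = 1 + (\<Sum>A\<in>\<A>. r A)"
  have \<rho>: "\<rho> > 0" unfolding \<rho>_def using r(1) by (intro add_pos_nonneg sum_nonneg) (auto intro: less_imp_le)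
  have r_le: "r A \<le> \<rho>" if "A \<in> \<A>" for A
    using member_le_sum[of A \<A> r] that r(1) \<open>finite \<A>\<close> by (auto simp: \<rho>_def less_imp_le)
  obtain C where C: "C \<ge> 0" "\<And>R. R \<ge> 0 \<Longrightarrow> finite {l\<in>L. norm l \<le> R}"
      "\<And>R. R \<ge> 0 \<Longrightarrow> real (card {l\<in>L. norm l \<le> R}) \<le> (1 + C * R) ^ DIM('a)"
    using polynomial_growth by auto
  \<comment> \<open>With an empty \<open>L\<close> the Parseval bound for \<open>S\<close> would
    read \<open>V * V / 2 \<le> 0\<close>.\<close>
  have "L \<noteq> {}"
  proof
    assume "L = {}"
    with parseval[of S "V * V / 2" 0] V show False by (auto simp: V_def field_simps)
  qed
  then obtain l0 where l0: "l0 \<in> L" by auto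
  define B where "B n = {l\<in>L. norm l \<le> norm l0 + \<rho> * real n}" for n
  have B: "finite (B n)" "real (card (B n)) \<le> (1 + C * (norm l0 + \<rho> * real n)) ^ DIM('a)" for n
    using C(2,3)[of "norm l0 + \<rho> * real n"] \<rho> by (simp_all add: B_def)
  have l0B: "l0 \<in> B n" for n using l0 \<rho> by (auto simp: B_def)
  \<comment> \<open>\<open>W\<close> dominates \<open>V * measure lborel A\<close> for every
    \<open>A\<close> in the family, so this \<kappa> limits the loss from the outer shell to
    \<open>\<epsilon> / 2\<close> per point of \<open>F\<close>. Parseval's identity and the tail
    cost a further \<open>\<epsilon> / 4\<close> each.\<close>
  define W where "W = V * (V + 1)"
  have "W > 0" using V by (simp add: W_def)
  define \<kappa> where "\<kappa> = \<epsilon> / 2 / W"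
  have "\<kappa> > 0" using \<open>W > 0\<close> \<open>\<epsilon> > 0\<close> by (simp add: \<kappa>_def)
  obtain n where n: "real (card (B (Suc n))) \<le> (1 + \<kappa>) * real (card (B n))"
  proof (rule slow_growth_step[of "\<lambda>n. real (card (B n))" \<kappa> "1 + C * norm l0" "C * \<rho>" "DIM('a)"])
    show "real (card (B 0)) > 0" using l0B[of 0] B(1)[of 0] by (auto simp: card_gt_0_iff)
    show "real (card (B n)) \<le> (1 + C * norm l0 + C * \<rho> * real n) ^ DIM('a)" for n
      using B(2)[of n] by (simp add: algebra_simps)
  qed (use \<open>\<kappa> > 0\<close> C(1) \<rho> in auto)
  define F where "F = B (Suc n)"
  have F: "finite F" "F \<subseteq> L" "F \<noteq> {}"
    using B(1)[of "Suc n"] l0B[of "Suc n"] by (auto simp: F_def) (simp add: B_def)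
  have BF: "B n \<subseteq> F" using \<rho> by (auto simp: F_def B_def algebra_simps)
  show thesis
  proof (rule that[OF F])
    fix A assume A: "A \<in> \<A>"
    define a where "a = measure lborel A"
    have a: "0 \<le> a" "a \<le> V"
      using measure_mono_fmeasurable[OF \<A>(2)[OF A]] fmeasurable_subset[of S] \<A>(1)[OF A]
      by (auto simp: a_def V_def)
    have inner: "V * a - \<epsilon> / 2 \<le> (\<Sum>l'\<in>F. (cmod (ft A (l - l')))\<^sup>2)" if l: "l \<in> B n" for l
    proof -
      define w where "w l' = (cmod (ft A (l - l')))\<^sup>2" for l'
      have w: "w l' \<ge> 0" for l' by (simp add: w_def)
      obtain G where G: "finite G" "G \<subseteq> L" "V * a - \<epsilon> / 4 \<le> sum w G"
        using parseval[OF \<A>[OF A], of "\<epsilon> / 4" l] \<open>\<epsilon> > 0\<close> by (auto simp: V_def a_def w_def)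
      have "G - F \<subseteq> {l'\<in>G. norm (l - l') \<ge> r A}"
      proof safe
        fix l' assume l': "l' \<in> G" "l' \<notin> F"
        then have "norm l' > norm l0 + \<rho> * real (Suc n)" using G(2) by (auto simp: F_def B_def)
        moreover have "norm l \<le> norm l0 + \<rho> * real n" using l by (simp add: B_def)
        moreover have "norm l' \<le> norm l + norm (l - l')"
          using norm_triangle_sub[of l' l] by (simp add: norm_minus_commute)
        ultimately show "r A \<le> norm (l - l')" using r_le[OF A] by (simp add: algebra_simps)
      qed
      then have "sum w (G - F) \<le> sum w {l'\<in>G. norm (l - l') \<ge> r A}"
        using G(1) w by (intro sum_mono2) auto
      also have "\<dots> \<le> \<epsilon> / 4" using r(2)[OF A G(1,2)] by (simp add: w_def)
      finally have "sum w (G - F) \<le> \<epsilon> / 4" .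
      moreover have "sum w G = sum w (G \<inter> F) + sum w (G - F)"
        using G(1) by (metis sum.Int_Diff)
      moreover have "sum w (G \<inter> F) \<le> sum w F"
        using F(1) w by (intro sum_mono2) auto
      ultimately show ?thesis using G(3) by (simp add: w_def)
    qed
    have "\<kappa> * real (card (B n)) * (V * a) \<le> \<kappa> * real (card F) * W"
      unfolding W_def using \<open>\<kappa> > 0\<close> V a card_mono[OF F(1) BF] by (intro mult_mono) auto
    also have "\<dots> = real (card F) * (\<epsilon> / 2)"
      using \<open>W > 0\<close> by (simp add: \<kappa>_def)
    finally have k: "\<kappa> * real (card (B n)) * (V * a) \<le> real (card F) * (\<epsilon> / 2)" .
    have "real (card F) * (V * a) \<le> (1 + \<kappa>) * real (card (B n)) * (V * a)"
      using n V a by (intro mult_right_mono) (auto simp: F_def)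
    then have "real (card F) * (V * a) - real (card F) * (\<epsilon> / 2) \<le> real (card (B n)) * (V * a)"
      using k by (simp add: algebra_simps)
    moreover have "real (card (B n)) * (\<epsilon> / 2) \<le> real (card F) * (\<epsilon> / 2)"
      using \<open>\<epsilon> > 0\<close> card_mono[OF F(1) BF] by (intro mult_right_mono) auto
    ultimately have "real (card F) * (V * a - \<epsilon>) \<le> real (card (B n)) * (V * a - \<epsilon> / 2)"
      by (simp add: algebra_simps)
    also have "\<dots> = (\<Sum>l\<in>B n. V * a - \<epsilon> / 2)" by simp
    also have "\<dots> \<le> (\<Sum>l\<in>B n. \<Sum>l'\<in>F. (cmod (ft A (l - l')))\<^sup>2)"
      by (intro sum_mono inner)
    also have "\<dots> \<le> (\<Sum>l\<in>F. \<Sum>l'\<in>F. (cmod (ft A (l - l')))\<^sup>2)"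
      using F BF by (intro sum_mono2) (auto intro: sum_nonneg)
    finally show "real (card F) * (measure lborel S * measure lborel A - \<epsilon>)
        \<le> (\<Sum>l\<in>F. \<Sum>l'\<in>F. (cmod (ft A (l - l')))\<^sup>2)"
      by (simp add: V_def a_def)
  qed
qed

end

section \<open>From the definition of spectrality to Borel sets\<close>

text \<open>Neither a null set nor the completion of the measure affects the integral. This lets the
  definitions over a Lebesgue measurable \<Omega> be read on a Borel subset of full measure.\<close>

lemma integral_lebesgue_on_eq:
  fixes g :: "'a::euclidean_space \<Rightarrow> 'b::{banach, second_countable_topology}"
  assumes \<Omega>: "\<Omega> \<in> sets lebesgue" and S [measurable]: "S \<in> sets borel" "S \<subseteq> \<Omega>" and null: "\<Omega> - S \<in> null_sets lebesgue"
    and g [measurable]: "g \<in> borel_measurable borel"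
  shows "(LINT x|lebesgue_on \<Omega>. g x) = (LINT x:S|lborel. g x)"
proof -
  have g_leb: "g \<in> borel_measurable lebesgue" by (simp add: measurable_completion)
  have "(LINT x|lebesgue_on \<Omega>. g x) = (LINT x|lebesgue. indicator \<Omega> x *\<^sub>R g x)"
    using \<Omega> by (subst integral_restrict_space) auto
  also have "\<dots> = (LINT x|lebesgue. indicator S x *\<^sub>R g x)"
  proof (rule integral_cong_AE)
    show "(\<lambda>x. indicat_real \<Omega> x *\<^sub>R g x) \<in> borel_measurable lebesgue"
      using g_leb \<Omega> by measurable
    show "(\<lambda>x. indicat_real S x *\<^sub>R g x) \<in> borel_measurable lebesgue"
      by (intro measurable_completion) simp
    show "AE x in lebesgue. indicat_real \<Omega> x *\<^sub>R g x = indicat_real S x *\<^sub>R g x"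
      using AE_not_in[OF null] by eventually_elim (use S(2) in \<open>auto simp: indicator_def\<close>)
  qed
  also have "\<dots> = (LINT x:S|lborel. g x)"
    unfolding set_lebesgue_integral_def by (rule integral_completion) simp
  finally show ?thesis .
qed

text \<open>Everything comes from the orthogonal expansion of the modulated difference
  \<open>f A A' \<xi>\<close> of two indicators: the optimal coefficients yield Bessel's inequality,
  and the coefficients supplied by completeness, with \<open>A' = {}\<close>, yield the Parseval
  bound.\<close>

lemma spectral_pairI:
  fixes \<Omega> S L :: "'a::euclidean_space set"
  assumes \<Omega>: "\<Omega> \<in> sets lebesgue" "bounded \<Omega>" and S [measurable]: "S \<in> sets borel" "S \<subseteq> \<Omega>"
    and null: "\<Omega> - S \<in> null_sets lebesgue" and pos: "measure lborel S > 0"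
    and L: "orthogonal_exponentials L \<Omega>" "complete_exponentials L \<Omega>"
  shows "spectral_pair S L"
proof -
  define M where "M = lebesgue_on \<Omega>"
  define V where "V = measure lborel S"
  note int_eq = integral_lebesgue_on_eq[OF \<Omega>(1) S null, folded M_def]
  have bS: "bounded S" using \<Omega>(2) S(2) bounded_subset by blast
  have \<Omega>_fin: "emeasure lebesgue \<Omega> < \<infinity>"
    using bounded_set_imp_lmeasurable[OF \<Omega>(2,1)] unfolding fmeasurable_def by blast
  have fin: "finite_measure M"
  proof (rule finite_measureI)
    have "emeasure M (space M) = emeasure lebesgue \<Omega>"
      unfolding M_def using \<Omega>(1) by (simp add: emeasure_restrict_space space_restrict_space)
    then show "emeasure M (space M) \<noteq> \<infinity>" using \<Omega>_fin by (simp only: less_imp_neq not_False_eq_True)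
  qed
  then interpret finite_measure M .
  have meas: "g \<in> borel_measurable M" if "g \<in> borel_measurable borel" for g :: "'a \<Rightarrow> complex"
    unfolding M_def using that by (simp add: measurable_completion measurable_restrict_space1)
  have V: "V = measure M (space M)" "V > 0"
  proof -
    have "measure M (space M) = (LINT x|M. 1)" by simp
    also have "\<dots> = V"
      unfolding int_eq[OF borel_measurable_const] using bounded_borel_fmeasurable[OF S(1) bS]
      by (simp add: set_lebesgue_integral_def V_def fmeasurable_def)
    finally show "V = measure M (space M)" ..
  qed (use pos in \<open>simp add: V_def\<close>)
  have ortho: "(LINT x|M. exponential l x * cnj (exponential l' x)) = 0" if "l \<in> L" "l' \<in> L" "l \<noteq> l'" for l l'
    using L(1) that by (auto simp: orthogonal_exponentials_def M_def)
  define f where "f A A' \<xi> x = (indicator A x - indicator A' x) * exponential \<xi> x" for A A' :: "'a set" and \<xi> x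
  have f_meas [measurable]: "f A A' \<xi> \<in> borel_measurable borel" if "A \<in> sets borel" "A' \<in> sets borel" for A A' \<xi>
    unfolding f_def using that by measurable
  have f_bound: "cmod (f A A' \<xi> x) \<le> 1" for A A' \<xi> x
    by (auto simp: f_def norm_mult indicator_def)
  have coeff: "(LINT x|M. f A A' \<xi> x * cnj (exponential l x)) = ft A (\<xi> - l) - ft A' (\<xi> - l)"
    if A: "A \<in> sets borel" "A \<subseteq> S" "A' \<in> sets borel" "A' \<subseteq> S" for A A' \<xi> l
  proof -
    have fm: "A \<in> fmeasurable lborel" "A' \<in> fmeasurable lborel"
      using A bS by (auto intro: bounded_borel_fmeasurable bounded_subset)
    have "(LINT x|M. f A A' \<xi> x * cnj (exponential l x)) = (LINT x:S|lborel. f A A' \<xi> x * cnj (exponential l x))"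
      using A by (intro int_eq borel_measurable_times f_meas borel_measurable_cnj measurable_exponential)
    also have "\<dots> = (LINT x|lborel. indicator A x *\<^sub>R exponential (\<xi> - l) x - indicator A' x *\<^sub>R exponential (\<xi> - l) x)"
      unfolding set_lebesgue_integral_def using A
      by (intro Bochner_Integration.integral_cong refl)
         (auto simp: f_def exponential_diff_left indicator_def)
    also have "\<dots> = ft A (\<xi> - l) - ft A' (\<xi> - l)"
      using set_integrable_exponential[OF fm(1)] set_integrable_exponential[OF fm(2)]
      by (simp add: set_integrable_def ft_def set_lebesgue_integral_def)
    finally show ?thesis .
  qed
  have norm: "(LINT x|M. (cmod (f A A' \<xi> x))\<^sup>2) = measure lborel ((A - A') \<union> (A' - A))"
    if A [measurable]: "A \<in> sets borel" "A \<subseteq> S" "A' \<in> sets borel" "A' \<subseteq> S" for A A' \<xi>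
  proof -
    have fm: "(A - A') \<union> (A' - A) \<in> fmeasurable lborel"
      using A bS by (auto intro!: bounded_borel_fmeasurable intro: bounded_subset)
    have "(LINT x|M. (cmod (f A A' \<xi> x))\<^sup>2) = (LINT x:S|lborel. (cmod (f A A' \<xi> x))\<^sup>2)"
      using A(1,3) by (intro int_eq) measurable
    also have "\<dots> = (LINT x|lborel. indicat_real ((A - A') \<union> (A' - A)) x)"
      unfolding set_lebesgue_integral_def using A
      by (intro Bochner_Integration.integral_cong refl) (auto simp: f_def norm_mult indicator_def)
    also have "\<dots> = measure lborel ((A - A') \<union> (A' - A))"
      using fm by (simp add: fmeasurable_def)
    finally show ?thesis .
  qed
  have expansion: "(LINT x|M. (cmod (f A A' \<xi> x - (\<Sum>l\<in>F. c l * exponential l x)))\<^sup>2) =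
      measure lborel ((A - A') \<union> (A' - A)) - (\<Sum>l\<in>F. (cmod (ft A (\<xi> - l) - ft A' (\<xi> - l)))\<^sup>2) / V
      + V * (\<Sum>l\<in>F. (cmod (c l - (ft A (\<xi> - l) - ft A' (\<xi> - l)) / V))\<^sup>2)"
    if A: "A \<in> sets borel" "A \<subseteq> S" "A' \<in> sets borel" "A' \<subseteq> S" and F: "finite F" "F \<subseteq> L" for A A' \<xi> F c
  proof -
    have "(LINT x|M. exponential l x * cnj (exponential l' x)) = 0" if "l \<in> F" "l' \<in> F" "l \<noteq> l'" for l l'
      using ortho that F(2) by blast
    from orthogonal_expansion[where e=exponential and f="f A A' \<xi>" and c=c,
        OF fin F(1) meas[OF measurable_exponential] norm_exponential this meas[OF f_meas[OF A(1,3)]] f_bound V]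
    show ?thesis unfolding coeff[OF A] norm[OF A] .
  qed
  show ?thesis
  proof
    fix l l' assume l: "l \<in> L" "l' \<in> L" "l \<noteq> l'"
    have "ft S (l - l') = (LINT x|M. exponential l x * cnj (exponential l' x))"
      unfolding ft_def exponential_diff_left by (intro int_eq[symmetric]) simp
    then show "ft S (l - l') = 0" using ortho[OF l] by simp
  next
    fix A A' F and \<xi> :: 'a
    assume A: "A \<in> sets borel" "A \<subseteq> S" "A' \<in> sets borel" "A' \<subseteq> S" and F: "finite F" "F \<subseteq> L"
    \<comment> \<open>These coefficients make the last sum of the expansion vanish.\<close>
    have "0 \<le> (LINT x|M. (cmod (f A A' \<xi> x - (\<Sum>l\<in>F. ((ft A (\<xi> - l) - ft A' (\<xi> - l)) / V) * exponential l x)))\<^sup>2)"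
      by (intro integral_nonneg_AE) auto
    also have "\<dots> = measure lborel ((A - A') \<union> (A' - A)) - (\<Sum>l\<in>F. (cmod (ft A (\<xi> - l) - ft A' (\<xi> - l)))\<^sup>2) / V"
      by (subst expansion[OF A F]) simp
    finally show "(\<Sum>l\<in>F. (cmod (ft A (\<xi> - l) - ft A' (\<xi> - l)))\<^sup>2)
        \<le> measure lborel S * measure lborel ((A - A') \<union> (A' - A))"
      using V(2) by (simp add: V_def[symmetric] field_simps)
  next
    fix A \<epsilon> and \<xi> :: 'a
    assume A: "A \<in> sets borel" "A \<subseteq> S" and "(\<epsilon>::real) > 0"
    have sq: "square_integrable_on (f A {} \<xi>) \<Omega>"
      unfolding square_integrable_on_def M_def[symmetric]
    proof
      show m: "f A {} \<xi> \<in> borel_measurable M" using A by (intro meas f_meas) auto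
      show "integrable M (\<lambda>x. (cmod (f A {} \<xi> x))\<^sup>2)"
        using m power_le_one[OF norm_ge_zero f_bound[of A "{}" \<xi>]]
        by (intro integrable_const_bound[where B=1]) simp_all
    qed
    \<comment> \<open>The expansion will be multiplied by \<open>V\<close>, so a squared distance
      below \<open>\<epsilon> / V\<close> costs \<epsilon>.\<close>
    have "sqrt (\<epsilon> / V) > 0" using \<open>\<epsilon> > 0\<close> V by simp
    then have "\<exists>F c. finite F \<and> F \<subseteq> L \<and>
        sqrt (LINT x|M. (cmod (f A {} \<xi> x - (\<Sum>l\<in>F. c l * exponential l x)))\<^sup>2) < sqrt (\<epsilon> / V)"
      by (rule L(2)[unfolded complete_exponentials_def, folded M_def, rule_format, OF sq])
    then obtain F c where F: "finite F" "F \<subseteq> L" and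
      "sqrt (LINT x|M. (cmod (f A {} \<xi> x - (\<Sum>l\<in>F. c l * exponential l x)))\<^sup>2) < sqrt (\<epsilon> / V)"
      by (elim exE conjE)
    then have "(LINT x|M. (cmod (f A {} \<xi> x - (\<Sum>l\<in>F. c l * exponential l x)))\<^sup>2) < \<epsilon> / V"
      by simp
    then have "measure lborel A - (\<Sum>l\<in>F. (cmod (ft A (\<xi> - l)))\<^sup>2) / V
        + V * (\<Sum>l\<in>F. (cmod (c l - ft A (\<xi> - l) / V))\<^sup>2) < \<epsilon> / V"
      using A F by (subst (asm) expansion) (auto simp: ft_def set_lebesgue_integral_def)
    moreover have "0 \<le> V * (\<Sum>l\<in>F. (cmod (c l - ft A (\<xi> - l) / V))\<^sup>2)"
      using V(2) by (intro mult_nonneg_nonneg sum_nonneg) auto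
    ultimately have "measure lborel A \<le> (\<epsilon> + (\<Sum>l\<in>F. (cmod (ft A (\<xi> - l)))\<^sup>2)) / V"
      unfolding add_divide_distrib by linarith
    then have "V * measure lborel A - \<epsilon> \<le> (\<Sum>l\<in>F. (cmod (ft A (\<xi> - l)))\<^sup>2)"
      using V(2) by (simp add: pos_le_divide_eq mult.commute)
    with F show "\<exists>F. finite F \<and> F \<subseteq> L \<and> measure lborel S * measure lborel A - \<epsilon> \<le> (\<Sum>l\<in>F. (cmod (ft A (\<xi> - l)))\<^sup>2)"
      by (auto simp: V_def)
  qed (use bS pos in simp_all)
qed

section \<open>The energy of exponential sums\<close>

text \<open>For an initial segment of the integers this is the classical Fejer kernel up to constant
  factors in value and variable. Evaluated at \<open>x - y\<close> it is the density of the measure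
  on pairs whose masses are compared below.\<close>

definition fejer :: "'a::euclidean_space set \<Rightarrow> 'a \<Rightarrow> real" where
  "fejer F x = (cmod (\<Sum>l\<in>F. exponential l x))\<^sup>2"

lemma fejer_nonneg [simp]: "fejer F x \<ge> 0"
  by (simp add: fejer_def)

lemma measurable_fejer [measurable]: "fejer F \<in> borel_measurable borel"
  unfolding fejer_def by measurable

lemma fejer_diff:
  "complex_of_real (fejer F (x - y)) =
    (\<Sum>l\<in>F. \<Sum>l'\<in>F. exponential (l - l') x * cnj (exponential (l - l') y))"
proof -
  have e: "exponential l (x - y) = exponential l x * cnj (exponential l y)" for l :: 'a
    using exponential_add_right[of l x "- y"] by (simp add: exponential_uminus_right cnj_exponential)
  show ?thesis
    unfolding fejer_def complex_norm_square
    by (simp add: e sum_product exponential_diff_left mult_ac)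
qed

text \<open>Expanding the square separates \<open>x\<close> from \<open>y\<close>, so each pair of
  frequencies contributes a product of two transforms. For \<open>A' = S\<close> orthogonality
  leaves the terms with \<open>l = l'\<close>; for \<open>A' = A\<close> the sum is the one that
  concentration bounds from below.\<close>

lemma fejer_energy:
  fixes A A' :: "'a::euclidean_space set"
  assumes A: "A \<in> fmeasurable lborel" and A': "A' \<in> fmeasurable lborel"
  shows "(\<integral>\<^sup>+x. \<integral>\<^sup>+y. indicator (A \<times> A') (x, y) * ennreal (fejer F (x - y)) \<partial>lborel \<partial>lborel) =
    ennreal (Re (\<Sum>l\<in>F. \<Sum>l'\<in>F. ft A (l - l') * cnj (ft A' (l - l'))))"
proof -
  have [measurable]: "A \<in> sets borel" "A' \<in> sets borel" using A A' by auto
  have ie: "integrable lborel (\<lambda>x. indicator A x *\<^sub>R exponential u x)" for u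
    using set_integrable_exponential[OF A] by (simp add: set_integrable_def)
  have ie': "integrable lborel (\<lambda>x. indicator A' x *\<^sub>R cnj (exponential u x))" for u
    using set_integrable_exponential[OF A', of "- u"] by (simp add: set_integrable_def cnj_exponential)
  have ft': "(LINT x|lborel. indicator A' x *\<^sub>R cnj (exponential u x)) = cnj (ft A' u)" for u
    using ft_uminus[of A' u] by (simp add: ft_def set_lebesgue_integral_def cnj_exponential)
  define g where "g x = (\<Sum>l\<in>F. \<Sum>l'\<in>F. exponential (l - l') x * cnj (ft A' (l - l')))" for x
  have hb: "has_bochner_integral lborel (\<lambda>y. indicator A' y * fejer F (x - y)) (Re (g x))" for x
  proof -
    have "has_bochner_integral lborel (\<lambda>y. \<Sum>l\<in>F. \<Sum>l'\<in>F. exponential (l - l') x *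
        (indicator A' y *\<^sub>R cnj (exponential (l - l') y))) (g x)"
      unfolding g_def ft'[symmetric]
      by (intro has_bochner_integral_sum has_bochner_integral_mult_right has_bochner_integral_integrable ie')
    also have "(\<lambda>y. \<Sum>l\<in>F. \<Sum>l'\<in>F. exponential (l - l') x *
        (indicator A' y *\<^sub>R cnj (exponential (l - l') y))) =
        (\<lambda>y. complex_of_real (indicator A' y * fejer F (x - y)))"
      unfolding of_real_mult fejer_diff sum_distrib_left
      by (intro ext sum.cong refl) (simp add: scaleR_conv_of_real mult_ac)
    finally have "has_bochner_integral lborel (\<lambda>y. Re (complex_of_real (indicator A' y * fejer F (x - y)))) (Re (g x))"
      by (rule has_bochner_integral_Re)
    then show ?thesis by simp
  qed
  have inner: "(\<integral>\<^sup>+y. ennreal (indicator A x * indicator A' y * fejer F (x - y)) \<partial>lborel) =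
      ennreal (indicator A x * Re (g x))" for x
  proof -
    have "has_bochner_integral lborel (\<lambda>y. indicator A x * indicator A' y * fejer F (x - y)) (indicator A x * Re (g x))"
      using has_bochner_integral_mult_right[OF hb[of x], of "indicator A x"] by (simp add: mult.assoc)
    then show ?thesis
      by (subst nn_integral_eq_integral) (auto simp: has_bochner_integral_iff)
  qed
  have g_nonneg: "indicator A x * Re (g x) \<ge> 0" for x
    using has_bochner_integral_integral_eq[OF hb[of x], symmetric] by simp
  have "has_bochner_integral lborel (\<lambda>x. \<Sum>l\<in>F. \<Sum>l'\<in>F. (indicator A x *\<^sub>R exponential (l - l') x) * cnj (ft A' (l - l')))
      (\<Sum>l\<in>F. \<Sum>l'\<in>F. ft A (l - l') * cnj (ft A' (l - l')))"
    unfolding ft_def[of A] set_lebesgue_integral_def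
    by (intro has_bochner_integral_sum has_bochner_integral_mult_left has_bochner_integral_integrable ie)
  also have "(\<lambda>x. \<Sum>l\<in>F. \<Sum>l'\<in>F. (indicator A x *\<^sub>R exponential (l - l') x) * cnj (ft A' (l - l'))) =
      (\<lambda>x. indicator A x *\<^sub>R g x)"
    by (simp add: g_def fun_eq_iff scaleR_sum_right)
  finally have "has_bochner_integral lborel (\<lambda>x. Re (indicator A x *\<^sub>R g x))
      (Re (\<Sum>l\<in>F. \<Sum>l'\<in>F. ft A (l - l') * cnj (ft A' (l - l'))))"
    by (rule has_bochner_integral_Re)
  then have "(\<integral>\<^sup>+x. ennreal (indicator A x * Re (g x)) \<partial>lborel) =
      ennreal (Re (\<Sum>l\<in>F. \<Sum>l'\<in>F. ft A (l - l') * cnj (ft A' (l - l'))))"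
    using g_nonneg by (subst nn_integral_eq_integral) (auto simp: has_bochner_integral_iff)
  moreover have "indicator (A \<times> A') (x, y) * ennreal (fejer F (x - y)) =
      ennreal (indicator A x * indicator A' y * fejer F (x - y))" for x y
    by (simp add: indicator_def)
  ultimately show ?thesis by (simp only: inner)
qed

section \<open>Masses of regions through overlaps of translates\<close>

text \<open>Fubini and the substitution \<open>x = y + t\<close>. For
  \<open>W = A \<times> A'\<close> the set on the right is the part of \<open>A'\<close> that the
  shift \<open>t\<close> carries into \<open>A\<close>.\<close>

lemma nn_integral_overlap:
  fixes W :: "('a::euclidean_space \<times> 'a) set"
  assumes [measurable]: "W \<in> sets borel" "K \<in> borel_measurable borel"
  shows "(\<integral>\<^sup>+x. \<integral>\<^sup>+y. indicator W (x, y) * K (x - y) \<partial>lborel \<partial>lborel) =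
    (\<integral>\<^sup>+t. K t * emeasure lborel {y. (y + t, y) \<in> W} \<partial>lborel)"
proof -
  have [measurable]: "W \<in> sets (borel \<Otimes>\<^sub>M borel)" using assms(1) by (simp only: borel_prod)
  have "(\<integral>\<^sup>+x. \<integral>\<^sup>+y. indicator W (x, y) * K (x - y) \<partial>lborel \<partial>lborel) =
      (\<integral>\<^sup>+y. \<integral>\<^sup>+x. indicator W (x, y) * K (x - y) \<partial>lborel \<partial>lborel)"
    by (rule lborel_pair.Fubini') measurable
  also have "\<dots> = (\<integral>\<^sup>+y. \<integral>\<^sup>+t. indicator W (y + t, y) * K t \<partial>lborel \<partial>lborel)"
  proof (rule nn_integral_cong)
    fix y :: 'a
    have "(\<integral>\<^sup>+x. indicator W (x, y) * K (x - y) \<partial>lborel) =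
        (\<integral>\<^sup>+x. indicator W (x, y) * K (x - y) \<partial>distr lborel borel ((+) y))"
      by (simp add: lborel_distr_plus)
    also have "\<dots> = (\<integral>\<^sup>+t. indicator W (y + t, y) * K t \<partial>lborel)"
      by (subst nn_integral_distr) simp_all
    finally show "(\<integral>\<^sup>+x. indicator W (x, y) * K (x - y) \<partial>lborel) =
        (\<integral>\<^sup>+t. indicator W (y + t, y) * K t \<partial>lborel)" .
  qed
  also have "\<dots> = (\<integral>\<^sup>+t. \<integral>\<^sup>+y. indicator W (y + t, y) * K t \<partial>lborel \<partial>lborel)"
    by (rule lborel_pair.Fubini') measurable
  also have "\<dots> = (\<integral>\<^sup>+t. K t * emeasure lborel {y. (y + t, y) \<in> W} \<partial>lborel)"
  proof (rule nn_integral_cong)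
    fix t :: 'a
    have "(\<integral>\<^sup>+y. indicator W (y + t, y) * K t \<partial>lborel) = (\<integral>\<^sup>+y. K t * indicator {y. (y + t, y) \<in> W} y \<partial>lborel)"
      by (intro nn_integral_cong) (auto simp: indicator_def)
    also have "\<dots> = K t * emeasure lborel {y. (y + t, y) \<in> W}"
      by (intro nn_integral_cmult_indicator) measurable
    finally show "(\<integral>\<^sup>+y. indicator W (y + t, y) * K t \<partial>lborel) = K t * emeasure lborel {y. (y + t, y) \<in> W}" .
  qed
  finally show ?thesis .
qed

lemma nn_integral_overlap_cmult:
  fixes W :: "('a::euclidean_space \<times> 'a) set"
  assumes [measurable]: "W \<in> sets borel" "K \<in> borel_measurable borel"
  shows "c * (\<integral>\<^sup>+x. \<integral>\<^sup>+y. indicator W (x, y) * K (x - y) \<partial>lborel \<partial>lborel) =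
    (\<integral>\<^sup>+t. K t * (c * emeasure lborel {y. (y + t, y) \<in> W}) \<partial>lborel)"
proof -
  have [measurable]: "W \<in> sets (borel \<Otimes>\<^sub>M borel)" using assms(1) by (simp only: borel_prod)
  have "c * (\<integral>\<^sup>+x. \<integral>\<^sup>+y. indicator W (x, y) * K (x - y) \<partial>lborel \<partial>lborel) =
      (\<integral>\<^sup>+x. \<integral>\<^sup>+y. indicator W (x, y) * (c * K (x - y)) \<partial>lborel \<partial>lborel)"
    by (subst nn_integral_cmult[symmetric], measurable)
       (simp add: nn_integral_cmult[symmetric] mult.left_commute)
  also have "\<dots> = (\<integral>\<^sup>+t. (c * K t) * emeasure lborel {y. (y + t, y) \<in> W} \<partial>lborel)"
    by (rule nn_integral_overlap) measurable
  finally show ?thesis by (simp only: mult_ac)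
qed

lemma emeasure_lborel_Times:
  fixes A :: "'a::euclidean_space set" and B :: "'b::euclidean_space set"
  assumes "A \<in> sets borel" "B \<in> sets borel"
  shows "emeasure lborel (A \<times> B) = emeasure lborel A * emeasure lborel B"
  unfolding lborel_prod[symmetric] using assms by (intro lborel.emeasure_pair_measure_Times) auto

text \<open>Subtraction in \<open>ennreal\<close>: the first inequality forces \<open>d\<close> to
  be finite, and the rest is real arithmetic.\<close>

lemma ennreal_add_le_imp_le:
  assumes "ennreal a + d \<le> ennreal b" "b - r \<le> a" "0 \<le> a" "0 \<le> b"
  shows "d \<le> ennreal r"
proof -
  have "d \<noteq> top"
    using assms(1) by (auto simp: top_unique)
  then obtain x where x: "d = ennreal x" "x \<ge> 0" by (cases d) auto
  then have "a + x \<le> b"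
    using assms(1,3,4) by (simp flip: ennreal_plus)
  then show ?thesis using assms(2) by (simp add: x(1) ennreal_leI)
qed

lemma borel_off_diagonal:
  fixes S :: "(real \<times> 'b::euclidean_space) set"
  assumes "S \<in> sets borel"
  shows "{(x, y). x \<in> S \<and> y \<in> S \<and> \<delta> \<le> \<bar>fst x - fst y\<bar>} \<in> sets borel"
proof -
  have "closed {p :: (real \<times> 'b) \<times> (real \<times> 'b). \<delta> \<le> \<bar>fst (fst p) - fst (snd p)\<bar>}"
    by (intro closed_Collect_le continuous_intros)
  moreover have "{(x, y). x \<in> S \<and> y \<in> S \<and> \<delta> \<le> \<bar>fst x - fst y\<bar>} =
      (S \<times> S) \<inter> {p. \<delta> \<le> \<bar>fst (fst p) - fst (snd p)\<bar>}" by auto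
  ultimately show ?thesis
    using borel_Times[OF assms assms] by (simp add: borel_closed sets.Int)
qed

text \<open>By the overlap formula it suffices to compare both sides at each shift
  \<open>(t, s)\<close>. If \<open>t\<close> carries some point of \<open>E\<close> into
  \<open>{u..v}\<close>, then |t| >= \<delta> and \<open>E\<close> overlaps its translate in measure
  at least \<open>c\<close>, while a part of \<open>E\<close> of measure at most
  \<open>v - u\<close> is carried into \<open>{u..v}\<close>. The factor coming from
  \<open>B\<close> is the same on both sides.\<close>

lemma overlap_comparison:
  fixes B :: "'b::euclidean_space set"
  assumes E [measurable]: "E \<in> sets borel" "bounded E" and B [measurable]: "B \<in> sets borel"
    and "u < v"
    and far: "\<And>x y. x \<in> {u..v} \<Longrightarrow> y \<in> E \<Longrightarrow> \<bar>x - y\<bar> \<ge> \<delta>"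
    and overlap: "\<And>x y. x \<in> {u..v} \<Longrightarrow> y \<in> E \<Longrightarrow> measure lborel (E \<inter> {z. z - (x - y) \<in> E}) \<ge> c"
    and K [measurable]: "K \<in> borel_measurable borel"
  defines "S \<equiv> E \<times> B"
  shows "ennreal c * (\<integral>\<^sup>+x. \<integral>\<^sup>+y. indicator (({u..v} \<times> B) \<times> S) (x, y) * K (x - y) \<partial>lborel \<partial>lborel)
    \<le> ennreal (v - u) * (\<integral>\<^sup>+x. \<integral>\<^sup>+y. indicator {(x, y). x \<in> S \<and> y \<in> S \<and> \<delta> \<le> \<bar>fst x - fst y\<bar>} (x, y) * K (x - y) \<partial>lborel \<partial>lborel)"
proof -
  define D :: "((real \<times> 'b) \<times> (real \<times> 'b)) set" where "D = {(x, y). x \<in> S \<and> y \<in> S \<and> \<delta> \<le> \<bar>fst x - fst y\<bar>}"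
  have S [measurable]: "S \<in> sets borel" unfolding S_def using E(1) B by (intro borel_Times)
  have W [measurable]: "(({u..v} \<times> B) \<times> S) \<in> sets borel" using B S by (intro borel_Times) auto
  have D [measurable]: "D \<in> sets borel" unfolding D_def using S by (rule borel_off_diagonal)
  have ptw: "ennreal c * emeasure lborel {y. (y + \<tau>, y) \<in> ({u..v} \<times> B) \<times> S}
      \<le> ennreal (v - u) * emeasure lborel {y. (y + \<tau>, y) \<in> D}" for \<tau> :: "real \<times> 'b"
  proof -
    obtain t s where \<tau>: "\<tau> = (t, s)" by (cases \<tau>)
    define J1 E1 B1 where "J1 = {y\<in>E. y + t \<in> {u..v}}" and "E1 = {y\<in>E. y + t \<in> E}" and "B1 = {y\<in>B. y + s \<in> B}"
    have [measurable]: "J1 \<in> sets borel" "E1 \<in> sets borel" "B1 \<in> sets borel"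
      unfolding J1_def E1_def B1_def by measurable
    have 1: "{y. (y + \<tau>, y) \<in> ({u..v} \<times> B) \<times> S} = J1 \<times> B1"
      by (auto simp: \<tau> J1_def B1_def S_def)
    show ?thesis
    proof (cases "J1 = {}")
      case True
      then show ?thesis unfolding 1 by simp
    next
      case False
      then obtain y where y: "y \<in> E" "y + t \<in> {u..v}" by (auto simp: J1_def)
      have "\<delta> \<le> \<bar>t\<bar>" using far[OF y(2,1)] by simp
      then have 2: "{y. (y + \<tau>, y) \<in> D} = E1 \<times> B1"
        by (auto simp: \<tau> E1_def B1_def S_def D_def)
      have "{x. x - t \<in> E1} = E \<inter> {z. z - t \<in> E}" by (auto simp: E1_def)
      then have "c \<le> measure lborel E1"
        using overlap[OF y(2,1)] measure_translate[of E1 t] by simp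
      moreover have "E1 \<in> fmeasurable lborel"
        using bounded_subset[OF E(2), of E1] by (intro bounded_borel_fmeasurable) (auto simp: E1_def)
      ultimately have c: "ennreal c \<le> emeasure lborel E1"
        by (simp add: emeasure_eq_measure2 ennreal_leI)
      have "emeasure lborel J1 \<le> emeasure lborel {u - t..v - t}"
        by (intro emeasure_mono) (auto simp: J1_def)
      then have "emeasure lborel J1 \<le> ennreal (v - u)" using \<open>u < v\<close> by simp
      then have "ennreal c * (emeasure lborel J1 * emeasure lborel B1) \<le> emeasure lborel E1 * (ennreal (v - u) * emeasure lborel B1)"
        using c by (intro mult_mono) auto
      then show ?thesis unfolding 1 2 by (simp add: emeasure_lborel_Times mult_ac)
    qed
  qed
  show ?thesis
    unfolding D_def[symmetric] nn_integral_overlap_cmult[OF W K] nn_integral_overlap_cmult[OF D K]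
    by (intro nn_integral_mono mult_left_mono ptw) simp
qed

text \<open>
  \<open>D\<close> collects the pairs at distance at least \<open>\<delta>\<close> in the first coordinate. By concentration on the
  cells, which are thinner than \<open>\<delta>\<close>, the kernel has little mass on \<open>D\<close>; by comparison of overlaps
  it has a fixed proportion of its mass there.
\<close>

lemma no_spectral_pair:
  fixes B :: "'b::euclidean_space set" and E :: "real set"
  assumes E: "E \<in> sets borel" "bounded E" and B: "B \<in> sets borel" "bounded B"
    and "u < v" "\<delta> > 0" "c > 0"
    and far: "\<And>x y. x \<in> {u..v} \<Longrightarrow> y \<in> E \<Longrightarrow> \<bar>x - y\<bar> \<ge> \<delta>"
    and overlap: "\<And>x y. x \<in> {u..v} \<Longrightarrow> y \<in> E \<Longrightarrow> measure lborel (E \<inter> {z. z - (x - y) \<in> E}) \<ge> c"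
  shows "\<not> spectral_pair (E \<times> B) L"
proof
  assume "spectral_pair (E \<times> B) L"
  then interpret spectral_pair "E \<times> B" L .
  define S where "S = E \<times> B"
  define V where "V = measure lborel S"
  have V: "V > 0" using S_pos by (simp add: V_def S_def)
  have S_fm: "S \<in> fmeasurable lborel"
    unfolding S_def by (intro fmeasurable_subset S_borel) simp
  define b where "b = measure lborel B"
  have B_fm: "B \<in> fmeasurable lborel" using B by (rule bounded_borel_fmeasurable)
  have E_fm: "E \<in> fmeasurable lborel" using E by (rule bounded_borel_fmeasurable)
  have Times: "measure lborel (A \<times> B) = measure lborel A * b" if "A \<in> fmeasurable lborel" for A :: "real set"
    using that B by (simp add: measure_def b_def emeasure_lborel_Times enn2real_mult fmeasurable_def)
  have "b > 0" using V Times[OF E_fm] by (auto simp: V_def S_def b_def zero_less_mult_iff not_less)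
  define X where "X = {u..v} \<times> B"
  have X_fm: "X \<in> fmeasurable lborel"
    unfolding X_def using B by (intro bounded_borel_fmeasurable borel_Times bounded_Times) auto
  have X: "measure lborel X = (v - u) * b"
    unfolding X_def using \<open>u < v\<close> by (subst Times) (auto simp: fmeasurable_compact)
  \<comment> \<open>Slices of \<open>S\<close> of width \<delta>: two points of the same slice have
    first coordinates less than \<delta> apart, so such a pair lies outside the off-diagonal
    region.\<close>
  define cell where "cell i = S \<inter> {p. \<lfloor>fst p / \<delta>\<rfloor> = i}" for i :: int
  define I where "I = (\<lambda>p. \<lfloor>fst p / \<delta>\<rfloor>) ` S"
  have "finite I"
  proof -
    obtain M where M: "\<And>x. x \<in> E \<Longrightarrow> \<bar>x\<bar> \<le> M" using E(2) by (auto simp: bounded_real)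
    have "\<lfloor>fst p / \<delta>\<rfloor> \<in> {\<lfloor>- M / \<delta>\<rfloor>..\<lfloor>M / \<delta>\<rfloor>}" if "p \<in> S" for p
    proof -
      have "fst p \<in> E" using that by (auto simp: S_def)
      then have "- M \<le> fst p" "fst p \<le> M" using M[of "fst p"] by auto
      then show ?thesis
        unfolding atLeastAtMost_iff using \<open>\<delta> > 0\<close> by (intro conjI floor_mono divide_right_mono) auto
    qed
    then have "I \<subseteq> {\<lfloor>- M / \<delta>\<rfloor>..\<lfloor>M / \<delta>\<rfloor>}" unfolding I_def by blast
    then show ?thesis by (rule finite_subset) simp
  qed
  have cell_borel [measurable]: "cell i \<in> sets borel" for i
  proof -
    have "cell i = S \<inter> (\<lambda>p. fst p / \<delta>) -` {of_int i..<of_int i + 1}"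
      by (auto simp: cell_def floor_eq_iff)
    moreover have m: "(\<lambda>p :: real \<times> 'b. fst p / \<delta>) \<in> borel_measurable borel"
      using \<open>\<delta> > 0\<close> by (intro borel_measurable_continuous_onI continuous_intros) simp
    have "(\<lambda>p :: real \<times> 'b. fst p / \<delta>) -` {of_int i..<of_int i + 1} \<in> sets borel"
      using measurable_sets[OF m, of "{of_int i..<of_int i + 1}"] by simp
    ultimately show ?thesis using S_borel unfolding S_def by (simp add: sets.Int)
  qed
  have cell_sub: "cell i \<subseteq> S" for i by (auto simp: cell_def)
  have cell_fm: "cell i \<in> fmeasurable lborel" for i
    using cell_sub by (intro fmeasurable_subset) (auto simp: S_def)
  have cell_sum: "(\<Sum>i\<in>I. measure lborel (cell i)) = V"
  proof -
    have "(\<Sum>i\<in>I. measure lborel (cell i)) = measure lborel (\<Union>i\<in>I. cell i)"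
      using \<open>finite I\<close> fmeasurableD2[OF cell_fm]
      by (intro measure_finite_Union[symmetric]) (auto simp: disjoint_family_on_def, auto simp: cell_def)
    also have "(\<Union>i\<in>I. cell i) = S" by (auto simp: cell_def I_def)
    finally show ?thesis by (simp add: V_def)
  qed
  \<comment> \<open>With this \<epsilon> the deficits of the \<open>card I\<close> cells add up to
    at most half of \<open>c * b * V\<close>, whereas the comparison of overlaps will require at
    least \<open>c * b * V\<close>. The added 1 keeps \<open>n\<close> positive.\<close>
  define n where "n = real (card I) + 1"
  have "n > 0" by (simp add: n_def)
  define \<epsilon> where "\<epsilon> = c * b * V / 2 / n"
  have "\<epsilon> > 0" using \<open>c > 0\<close> \<open>b > 0\<close> V \<open>n > 0\<close> by (simp add: \<epsilon>_def)
  obtain F where F: "finite F" "F \<subseteq> L" "F \<noteq> {}" and conc: "\<And>A. A \<in> cell ` I \<Longrightarrow>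
      real (card F) * (V * measure lborel A - \<epsilon>) \<le> (\<Sum>l\<in>F. \<Sum>l'\<in>F. (cmod (ft A (l - l')))\<^sup>2)"
  proof (rule concentration[of "cell ` I" \<epsilon>])
    show "finite (cell ` I)" "\<epsilon> > 0" using \<open>finite I\<close> \<open>\<epsilon> > 0\<close> by auto
    show "A \<in> sets borel" "A \<subseteq> E \<times> B" if "A \<in> cell ` I" for A
      using that cell_borel cell_sub by (auto simp: S_def)
  next
    fix F
    assume F: "finite F" "F \<subseteq> L" "F \<noteq> {}" and "\<And>A. A \<in> cell ` I \<Longrightarrow>
      real (card F) * (measure lborel (E \<times> B) * measure lborel A - \<epsilon>)
        \<le> (\<Sum>l\<in>F. \<Sum>l'\<in>F. (cmod (ft A (l - l')))\<^sup>2)"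
    then show thesis unfolding S_def[symmetric] V_def[symmetric] by (intro that)
  qed
  define N where "N = real (card F)"
  have "N > 0" using F by (auto simp: N_def card_gt_0_iff)
  define K where "K x = ennreal (fejer F x)" for x
  have K_meas [measurable]: "K \<in> borel_measurable borel" unfolding K_def by measurable
  define energy where "energy W = (\<integral>\<^sup>+x. \<integral>\<^sup>+y. indicator W (x, y) * K (x - y) \<partial>lborel \<partial>lborel)"
    for W :: "((real \<times> 'b) \<times> (real \<times> 'b)) set"
  \<comment> \<open>By orthogonality \<open>ft S (l - l')\<close> vanishes for distinct frequencies,
    so each of the \<open>N\<close> points of \<open>F\<close> contributes
    \<open>measure lborel A * V\<close>.\<close>
  have energy_S: "energy (A \<times> S) = ennreal (N * (measure lborel A * V))" if A: "A \<in> fmeasurable lborel" for A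
  proof -
    have "(\<Sum>l\<in>F. \<Sum>l'\<in>F. ft A (l - l') * cnj (ft S (l - l'))) =
        (\<Sum>l\<in>F. \<Sum>l'\<in>F. if l = l' then complex_of_real (measure lborel A * V) else 0)"
    proof (intro sum.cong refl)
      fix l l' assume "l \<in> F" "l' \<in> F"
      then have "ft S (l - l') = 0" if "l \<noteq> l'"
        using that F(2) orthogonal[of l l'] unfolding S_def by blast
      then show "ft A (l - l') * cnj (ft S (l - l')) = (if l = l' then complex_of_real (measure lborel A * V) else 0)"
        using ft_0[OF A] ft_0[OF S_fm] by (cases "l = l'") (simp_all add: V_def)
    qed
    also have "\<dots> = complex_of_real (N * (measure lborel A * V))"
      using F(1) by (simp add: N_def)
    finally show ?thesis
      unfolding energy_def K_def fejer_energy[OF A S_fm] by simp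
  qed
  define h where "h i = (\<Sum>l\<in>F. \<Sum>l'\<in>F. (cmod (ft (cell i) (l - l')))\<^sup>2)" for i
  have energy_cell: "energy (cell i \<times> cell i) = ennreal (h i)" for i
    unfolding energy_def K_def fejer_energy[OF cell_fm cell_fm] h_def
    by (simp only: complex_norm_square[symmetric] of_real_sum[symmetric] Re_complex_of_real)
  define D where "D = {(x, y). x \<in> S \<and> y \<in> S \<and> \<delta> \<le> \<bar>fst x - fst y\<bar>}"
  have S_borel': "S \<in> sets borel" unfolding S_def by (rule S_borel)
  have D_borel: "D \<in> sets borel" unfolding D_def using S_borel' by (rule borel_off_diagonal)
  have energy_eq: "energy W = (\<integral>\<^sup>+p. indicator W p * K (fst p - snd p) \<partial>lborel)" if "W \<in> sets borel" for W
  proof -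
    have [measurable]: "W \<in> sets (borel \<Otimes>\<^sub>M borel)" using that by (simp only: borel_prod)
    have "(\<integral>\<^sup>+x. \<integral>\<^sup>+y. indicator W (x, y) * K (fst (x, y) - snd (x, y)) \<partial>lborel \<partial>lborel) =
        (\<integral>\<^sup>+p. indicator W p * K (fst p - snd p) \<partial>(lborel \<Otimes>\<^sub>M lborel))"
      by (rule lborel.nn_integral_fst) measurable
    then show ?thesis by (simp add: energy_def lborel_prod)
  qed
  \<comment> \<open>The squares of the cells and \<open>D\<close> are pairwise disjoint subsets of
    \<open>S \<times> S\<close>, so their masses add up to at most that of
    \<open>S \<times> S\<close>.\<close>
  have cells_D: "(\<Sum>i\<in>I. indicator (cell i \<times> cell i) p) + indicator D p \<le> (indicator (S \<times> S) p :: ennreal)" for p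
  proof -
    obtain x y where p: "p = (x, y)" by (cases p)
    show ?thesis
    proof (cases "x \<in> S \<and> y \<in> S")
      case False
      then have "p \<notin> cell i \<times> cell i" "p \<notin> D" for i
        using cell_sub[of i] by (auto simp: p D_def)
      then show ?thesis by simp
    next
      case True
      define i where "i = \<lfloor>fst x / \<delta>\<rfloor>"
      have "i \<in> I" using True by (auto simp: i_def I_def)
      have ind: "indicator (cell j \<times> cell j) p = (if j = i then if \<lfloor>fst y / \<delta>\<rfloor> = i then 1 else 0 else 0 :: ennreal)" for j
        using True by (auto simp: cell_def p i_def indicator_def)
      have D: "indicator D p = (0 :: ennreal)" if "\<lfloor>fst y / \<delta>\<rfloor> = i"
      proof -
        have "\<bar>fst x / \<delta> - fst y / \<delta>\<bar> < 1"
          using that unfolding i_def by linarith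
        then have "\<bar>fst x - fst y\<bar> < \<delta>"
          using \<open>\<delta> > 0\<close> by (simp add: diff_divide_distrib[symmetric] abs_divide)
        then show ?thesis by (auto simp: D_def p)
      qed
      have sum: "(\<Sum>j\<in>I. indicator (cell j \<times> cell j) p) = (if \<lfloor>fst y / \<delta>\<rfloor> = i then 1 else 0 :: ennreal)"
        unfolding ind using \<open>i \<in> I\<close> \<open>finite I\<close> by (simp add: sum.delta')
      have "indicator (S \<times> S) p = (1 :: ennreal)" using True by (simp add: p)
      then show ?thesis
        using D unfolding sum by (cases "p \<in> D") auto
    qed
  qed
  have "(\<Sum>i\<in>I. energy (cell i \<times> cell i)) + energy D \<le> energy (S \<times> S)"
  proof -
    have cc: "cell i \<times> cell i \<in> sets borel" for i by (intro borel_Times cell_borel)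
    have m: "(\<lambda>p. indicator W p * K (fst p - snd p)) \<in> borel_measurable lborel"
      if "W \<in> sets borel" for W :: "((real \<times> 'b) \<times> (real \<times> 'b)) set"
    proof -
      have "(\<lambda>p :: (real \<times> 'b) \<times> (real \<times> 'b). fst p - snd p) \<in> borel_measurable borel"
        by (intro borel_measurable_continuous_onI continuous_intros)
      from measurable_compose[OF this K_meas] that show ?thesis by simp
    qed
    have "(\<Sum>i\<in>I. energy (cell i \<times> cell i)) + energy D =
        (\<integral>\<^sup>+p. (\<Sum>i\<in>I. indicator (cell i \<times> cell i) p * K (fst p - snd p)) + indicator D p * K (fst p - snd p) \<partial>lborel)"
      using m[OF cc] m[OF D_borel]
      by (simp add: energy_eq cc D_borel nn_integral_add nn_integral_sum)
    also have "\<dots> \<le> (\<integral>\<^sup>+p. indicator (S \<times> S) p * K (fst p - snd p) \<partial>lborel)"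
      unfolding sum_distrib_right[symmetric] distrib_right[symmetric]
      by (intro nn_integral_mono mult_right_mono cells_D) simp
    also have "\<dots> = energy (S \<times> S)"
      by (intro energy_eq[symmetric] borel_Times S_borel')
    finally show ?thesis .
  qed
  then have "ennreal (\<Sum>i\<in>I. h i) + energy D \<le> ennreal (N * (V * V))"
    using energy_S[OF S_fm] by (simp add: energy_cell V_def h_def sum_nonneg)
  moreover have "N * (V * V) - N * (real (card I) * \<epsilon>) \<le> (\<Sum>i\<in>I. h i)"
  proof -
    have "N * (V * V) - N * (real (card I) * \<epsilon>) = (\<Sum>i\<in>I. N * (V * measure lborel (cell i) - \<epsilon>))"
      by (simp add: right_diff_distrib sum_subtractf sum_distrib_left[symmetric] cell_sum)
    also have "\<dots> \<le> (\<Sum>i\<in>I. h i)"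
      using conc by (intro sum_mono) (auto simp: N_def h_def)
    finally show ?thesis .
  qed
  moreover have "0 \<le> (\<Sum>i\<in>I. h i)" unfolding h_def by (intro sum_nonneg) simp
  moreover have "0 \<le> N * (V * V)" using \<open>N > 0\<close> by simp
  ultimately have D_small: "energy D \<le> ennreal (N * (real (card I) * \<epsilon>))"
    by (rule ennreal_add_le_imp_le)
  \<comment> \<open>Orthogonality gives \<open>X \<times> S\<close> the mass
    \<open>N * ((v - u) * b * V)\<close> although \<open>X\<close> is disjoint from
    \<open>S\<close>; this has to fit into a fixed multiple of the small mass of
    \<open>D\<close>.\<close>
  have "ennreal c * energy (X \<times> S) \<le> ennreal (v - u) * energy D"
    using overlap_comparison[OF E B(1) \<open>u < v\<close> far overlap K_meas]
    unfolding energy_def X_def S_def D_def .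
  also have "\<dots> \<le> ennreal (v - u) * ennreal (N * (real (card I) * \<epsilon>))"
    by (intro mult_left_mono D_small) simp
  finally have "ennreal (c * (N * ((v - u) * b * V))) \<le> ennreal ((v - u) * (N * (real (card I) * \<epsilon>)))"
    using \<open>c > 0\<close> \<open>u < v\<close> by (simp add: energy_S[OF X_fm] X flip: ennreal_mult')
  then have "c * (N * ((v - u) * b * V)) \<le> (v - u) * (N * (real (card I) * \<epsilon>))"
    using \<open>u < v\<close> \<open>N > 0\<close> \<open>\<epsilon> > 0\<close> by (subst (asm) ennreal_le_iff) auto
  then have "((v - u) * N) * (c * b * V) \<le> ((v - u) * N) * (real (card I) * \<epsilon>)"
    by (simp only: mult_ac)
  moreover have "(v - u) * N > 0" using \<open>u < v\<close> \<open>N > 0\<close> by simp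
  ultimately have "c * b * V \<le> real (card I) * \<epsilon>" by (rule mult_left_le_imp_le)
  moreover have "real (card I) * \<epsilon> < c * b * V"
  proof -
    have "real (card I) * \<epsilon> \<le> n * \<epsilon>" using \<open>\<epsilon> > 0\<close> by (simp add: n_def)
    also have "\<dots> = c * b * V / 2" using \<open>n > 0\<close> by (simp add: \<epsilon>_def)
    also have "\<dots> < c * b * V" using \<open>c > 0\<close> \<open>b > 0\<close> V by simp
    finally show ?thesis .
  qed
  ultimately show False by simp
qed

section \<open>Gaps of symmetric Cantor sets\<close>

definition interval_length :: "(nat \<Rightarrow> real) \<Rightarrow> nat \<Rightarrow> real" where
  "interval_length \<xi> k = (\<Prod>i=1..k. \<xi> i)"

text \<open>Left endpoints of the intervals \<open>j\<close> steps after step \<open>k\<close>,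
  measured from the left endpoint of an interval of step \<open>k\<close>. Intervals of one step
  share their length, so left endpoints determine them. Starting at an arbitrary \<open>k\<close>
  makes visible that all intervals of that step are subdivided in the same way.\<close>

primrec tail_starts :: "(nat \<Rightarrow> real) \<Rightarrow> nat \<Rightarrow> nat \<Rightarrow> real set" where
  "tail_starts \<xi> k 0 = {0}"
| "tail_starts \<xi> k (Suc j) = tail_starts \<xi> k j \<union>
     (\<lambda>t. t + (interval_length \<xi> (k + j) - interval_length \<xi> (Suc (k + j)))) ` tail_starts \<xi> k j"

definition tail_level :: "(nat \<Rightarrow> real) \<Rightarrow> nat \<Rightarrow> nat \<Rightarrow> real set" where
  "tail_level \<xi> k j = (\<Union>t\<in>tail_starts \<xi> k j. {t..t + interval_length \<xi> (k + j)})"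

text \<open>For ratios between 0 and 1/2 this is the part of the Cantor set in its leftmost interval
  of step \<open>k\<close>; the other intervals of that step contain translates of it.\<close>

definition tail_cantor :: "(nat \<Rightarrow> real) \<Rightarrow> nat \<Rightarrow> real set" where
  "tail_cantor \<xi> k = (\<Inter>j. tail_level \<xi> k j)"

lemma interval_length_0 [simp]: "interval_length \<xi> 0 = 1"
  by (simp add: interval_length_def)

lemma interval_length_Suc: "interval_length \<xi> (Suc k) = \<xi> (Suc k) * interval_length \<xi> k"
  by (simp add: interval_length_def mult.commute)

lemma cantor_intervals_eq:
  "cantor_intervals \<xi> k = (\<lambda>a. (a, a + interval_length \<xi> k)) ` tail_starts \<xi> 0 k"
proof (induction k)
  case (Suc k)
  have "cantor_intervals \<xi> (Suc k) = (\<Union>a\<in>tail_starts \<xi> 0 k.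
      {(a, a + interval_length \<xi> (Suc k)),
       (a + interval_length \<xi> k - interval_length \<xi> (Suc k), a + interval_length \<xi> k)})"
    by (simp add: Suc.IH interval_length_Suc)
  also have "\<dots> = (\<lambda>a. (a, a + interval_length \<xi> (Suc k))) ` tail_starts \<xi> 0 (Suc k)"
    by (auto simp: image_iff algebra_simps)
  finally show ?case .
qed simp

lemma cantor_set_eq: "cantor_set \<xi> = tail_cantor \<xi> 0"
  by (simp add: cantor_set_def tail_cantor_def tail_level_def cantor_intervals_eq)

lemma cantor_set_in_level: "x \<in> cantor_set \<xi> \<Longrightarrow> x \<in> tail_level \<xi> 0 k"
  by (simp add: cantor_set_eq tail_cantor_def)

lemma finite_tail_starts: "finite (tail_starts \<xi> k j)"
  by (induction j) auto

lemma card_tail_starts: "card (tail_starts \<xi> k j) \<le> 2 ^ j"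
proof (induction j)
  case (Suc j)
  have "card (tail_starts \<xi> k (Suc j)) \<le> card (tail_starts \<xi> k j) + card (tail_starts \<xi> k j)"
    unfolding tail_starts.simps
    by (rule order_trans[OF card_Un_le]) (simp add: card_image_le finite_tail_starts)
  with Suc.IH show ?case by simp
qed simp

lemma compact_tail_level: "compact (tail_level \<xi> k j)"
  unfolding tail_level_def by (intro compact_UN finite_tail_starts) auto

lemma tail_level_fmeasurable: "tail_level \<xi> k j \<in> fmeasurable lborel"
  by (intro fmeasurable_compact compact_tail_level)

lemma zero_in_tail_starts: "0 \<in> tail_starts \<xi> k j"
  by (induction j) auto

lemma tail_starts_add:
  "a \<in> tail_starts \<xi> 0 k \<Longrightarrow> t \<in> tail_starts \<xi> k j \<Longrightarrow> a + t \<in> tail_starts \<xi> 0 (k + j)"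
proof (induction j arbitrary: t)
  case (Suc j)
  then show ?case
    by (auto simp: image_iff add.assoc)
qed simp

section \<open>Measures and gaps for ratios between 0 and 1/2\<close>

context
  fixes \<xi> :: "nat \<Rightarrow> real"
  assumes ratio: "\<forall>k\<ge>1. 0 < \<xi> k \<and> \<xi> k < 1/2"
begin

lemma interval_length_pos: "interval_length \<xi> k > 0"
  unfolding interval_length_def using ratio by (intro prod_pos) auto

lemma interval_length_Suc_less: "2 * interval_length \<xi> (Suc k) < interval_length \<xi> k"
  using ratio[rule_format, of "Suc k"] interval_length_pos[of k] by (simp add: interval_length_Suc)

lemma tail_level_decreasing: "tail_level \<xi> k (Suc j) \<subseteq> tail_level \<xi> k j"
proof -
  have "0 < interval_length \<xi> (Suc (k + j))" "2 * interval_length \<xi> (Suc (k + j)) < interval_length \<xi> (k + j)"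
    using interval_length_pos interval_length_Suc_less by auto
  then show ?thesis
    unfolding tail_level_def by (auto intro: order_trans)
qed

lemma decseq_tail_level: "decseq (tail_level \<xi> k)"
  using tail_level_decreasing by (intro decseq_SucI)

lemma tail_cantor_subset: "tail_cantor \<xi> k \<subseteq> {0..interval_length \<xi> k}"
  using INT_lower[of 0 UNIV "tail_level \<xi> k"] by (simp add: tail_cantor_def tail_level_def)

lemma compact_tail_cantor: "compact (tail_cantor \<xi> k)"
  unfolding tail_cantor_def by (intro compact_Inter) (auto simp: compact_tail_level)

text \<open>The levels decrease, so it is enough to look at the levels \<open>k + j\<close>, where
  the starts simply add.\<close>

lemma translate_tail_cantor_subset:
  assumes "a \<in> tail_starts \<xi> 0 k" "x \<in> tail_cantor \<xi> k"
  shows "a + x \<in> cantor_set \<xi>"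
proof -
  have *: "a + x \<in> tail_level \<xi> 0 (k + j)" for j
  proof -
    obtain t where "t \<in> tail_starts \<xi> k j" "x \<in> {t..t + interval_length \<xi> (k + j)}"
      using assms(2) by (auto simp: tail_cantor_def tail_level_def)
    with tail_starts_add[OF assms(1)] show ?thesis
      unfolding tail_level_def by (intro UN_I[of "a + t"]) auto
  qed
  have "a + x \<in> tail_level \<xi> 0 j" for j
    using *[of j] decseqD[OF decseq_tail_level, of j "k + j" 0] by auto
  then show ?thesis by (simp add: cantor_set_eq tail_cantor_def)
qed

lemma measure_tail_level_le: "measure lborel (tail_level \<xi> k j) \<le> 2 ^ j * interval_length \<xi> (k + j)"
proof -
  have "measure lborel (tail_level \<xi> k j) \<le>
      (\<Sum>t\<in>tail_starts \<xi> k j. measure lborel {t..t + interval_length \<xi> (k + j)})"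
    unfolding tail_level_def
    by (intro measure_UNION_le finite_tail_starts) auto
  also have "\<dots> = card (tail_starts \<xi> k j) * interval_length \<xi> (k + j)"
    using interval_length_pos[of "k + j"] by simp
  also have "\<dots> \<le> real (2 ^ j) * interval_length \<xi> (k + j)"
    using interval_length_pos[of "k + j"]
    by (intro mult_right_mono) (auto intro: card_tail_starts simp flip: of_nat_power)
  finally show ?thesis by simp
qed

text \<open>
  Only subadditivity is used: passing to the next level removes at most \<open>2 ^ j\<close> gaps.
\<close>

lemma measure_tail_level_ge: "2 ^ j * interval_length \<xi> (k + j) \<le> measure lborel (tail_level \<xi> k j)"
proof (induction j)
  case 0
  show ?case using interval_length_pos[of k] by (simp add: tail_level_def)
next
  case (Suc j)
  define l l' where "l = interval_length \<xi> (k + j)" and "l' = interval_length \<xi> (Suc (k + j))"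
  have l: "0 < l'" "2 * l' < l"
    using interval_length_pos interval_length_Suc_less by (auto simp: l_def l'_def)
  define G where "G = (\<Union>t\<in>tail_starts \<xi> k j. {t + l'..t + (l - l')})"
  have G: "G \<in> fmeasurable lborel"
    unfolding G_def by (intro fmeasurable_compact compact_UN finite_tail_starts) simp
  have "tail_level \<xi> k j \<subseteq> tail_level \<xi> k (Suc j) \<union> G"
  proof
    fix x assume "x \<in> tail_level \<xi> k j"
    then obtain t where t: "t \<in> tail_starts \<xi> k j" "t \<le> x" "x \<le> t + l"
      by (auto simp: tail_level_def l_def)
    consider "x \<le> t + l'" | "x \<in> {t + l'..t + (l - l')}" | "t + (l - l') \<le> x"
      unfolding atLeastAtMost_iff by linarith
    then show "x \<in> tail_level \<xi> k (Suc j) \<union> G"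
    proof cases
      case 1
      then have "x \<in> {t..t + interval_length \<xi> (k + Suc j)}"
        using t by (simp add: l'_def)
      moreover have "t \<in> tail_starts \<xi> k (Suc j)"
        using t by simp
      ultimately show ?thesis unfolding tail_level_def by (intro UnI1 UN_I)
    next
      case 2
      then show ?thesis using t unfolding G_def by blast
    next
      case 3
      then have "x \<in> {t + (l - l')..t + (l - l') + interval_length \<xi> (k + Suc j)}"
        using t by (auto simp: l'_def)
      moreover have "t + (l - l') \<in> tail_starts \<xi> k (Suc j)"
        using t by (auto simp: l_def l'_def)
      ultimately show ?thesis unfolding tail_level_def by (intro UnI1 UN_I)
    qed
  qed
  then have "measure lborel (tail_level \<xi> k j) \<le> measure lborel (tail_level \<xi> k (Suc j) \<union> G)"
    by (intro measure_mono_fmeasurable fmeasurable.Un G tail_level_fmeasurable fmeasurableD)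
  also have "\<dots> \<le> measure lborel (tail_level \<xi> k (Suc j)) + measure lborel G"
    by (intro measure_Un_le fmeasurableD G tail_level_fmeasurable)
  also have "measure lborel G \<le> (\<Sum>t\<in>tail_starts \<xi> k j. measure lborel {t + l'..t + (l - l')})"
    unfolding G_def by (intro measure_UNION_le finite_tail_starts) simp
  also have "\<dots> = card (tail_starts \<xi> k j) * (l - 2 * l')"
    using l by simp
  also have "\<dots> \<le> real (2 ^ j) * (l - 2 * l')"
    using l by (intro mult_right_mono) (auto intro: card_tail_starts simp flip: of_nat_power)
  finally show ?case
    using Suc.IH by (simp add: l_def l'_def algebra_simps)
qed

lemma tail_cantor_measure_limit:
  "(\<lambda>j. measure lborel (tail_level \<xi> k j)) \<longlonglongrightarrow> measure lborel (tail_cantor \<xi> k)"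
  unfolding tail_cantor_def
proof (rule Lim_measure_decseq)
  show "range (tail_level \<xi> k) \<subseteq> sets lborel"
    using compact_tail_level borel_compact by auto
  show "emeasure lborel (tail_level \<xi> k i) \<noteq> \<infinity>" for i
    using emeasure_compact_finite[OF compact_tail_level[of \<xi> k i]] by auto
qed (rule decseq_tail_level)

text \<open>In the induction the start 0 produces 0 and \<open>l' - l''\<close>, and a start that is
  at least \<open>l - l'\<close> stays beyond \<open>l' - l''\<close> because
  \<open>l - l' > l'\<close>. This locates the gap that step \<open>k + 1\<close> opens in the
  leftmost interval of step \<open>k\<close>.\<close>

lemma tail_starts_0_cases:
  "a \<in> tail_starts \<xi> 0 (Suc k) \<Longrightarrow>
    a = 0 \<or> a \<ge> interval_length \<xi> k - interval_length \<xi> (Suc k)"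
proof (induction k arbitrary: a)
  case (Suc k)
  define l l' l'' where "l = interval_length \<xi> k" and "l' = interval_length \<xi> (Suc k)"
    and "l'' = interval_length \<xi> (Suc (Suc k))"
  have l: "0 < l''" "2 * l'' < l'" "2 * l' < l"
    using interval_length_pos interval_length_Suc_less by (auto simp: l_def l'_def l''_def)
  from Suc.prems obtain b where b: "b \<in> tail_starts \<xi> 0 (Suc k)" "a = b \<or> a = b + (l' - l'')"
    by (auto simp: l'_def l''_def simp del: tail_starts.simps(2) simp: tail_starts.simps(2)[of _ _ "Suc k"])
  with Suc.IH[of b] l show ?case
    by (auto simp: l_def l'_def l''_def)
qed auto

lemma cantor_set_misses_first_gap:
  assumes "x \<in> cantor_set \<xi>"
  shows "x \<le> interval_length \<xi> (Suc k) \<or> x \<ge> interval_length \<xi> k - interval_length \<xi> (Suc k)"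
proof -
  obtain a where "a \<in> tail_starts \<xi> 0 (Suc k)" "a \<le> x" "x \<le> a + interval_length \<xi> (Suc k)"
    using cantor_set_in_level[OF assms, of "Suc k"]
    by (auto simp: tail_level_def simp del: tail_starts.simps)
  with tail_starts_0_cases[of a k] show ?thesis by auto
qed

text \<open>Level \<open>k\<close> has measure \<open>m k\<close>, which decreases to the positive
  measure \<mu> of the whole set, and the tail has measure \<open>\<mu> / 2 ^ k\<close>. Hence the
  tail fills the proportion \<open>\<mu> / m k\<close> of its interval, which tends to 1; since
  \<open>m (Suc k) \<ge> \<mu>\<close>, the same \<open>k\<close> gives the second bound.\<close>

lemma dense_tail:
  assumes "measure lborel (cantor_set \<xi>) > 0"
  obtains k where "measure lborel (tail_cantor \<xi> k) \<ge> 9/10 * interval_length \<xi> k"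
    and "interval_length \<xi> (Suc k) \<ge> 9/20 * interval_length \<xi> k"
proof -
  define m where "m k = 2 ^ k * interval_length \<xi> k" for k
  define \<mu> where "\<mu> = measure lborel (cantor_set \<xi>)"
  have eq: "measure lborel (tail_level \<xi> k j) = m (k + j) / 2 ^ k" for k j
    using measure_tail_level_le[of k j] measure_tail_level_ge[of j k]
    by (simp add: m_def power_add field_simps)
  have lim: "m \<longlonglongrightarrow> \<mu>"
    using tail_cantor_measure_limit[of 0] by (simp add: eq cantor_set_eq \<mu>_def)
  have m_Suc: "m (Suc k) \<le> m k" for k
    using interval_length_Suc_less[of k] by (simp add: m_def)
  have ge: "m k \<ge> \<mu>" for k
    by (rule decseq_ge[OF decseq_SucI lim]) (rule m_Suc)
  have tail: "measure lborel (tail_cantor \<xi> k) = \<mu> / 2 ^ k" for k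
  proof (rule LIMSEQ_unique[OF tail_cantor_measure_limit])
    have "(\<lambda>j. m (j + k)) \<longlonglongrightarrow> \<mu>"
      using lim by (rule LIMSEQ_ignore_initial_segment)
    then show "(\<lambda>j. measure lborel (tail_level \<xi> k j)) \<longlonglongrightarrow> \<mu> / 2 ^ k"
      unfolding eq by (intro tendsto_divide) (auto simp: add.commute)
  qed
  have "\<mu> > 0" using assms by (simp add: \<mu>_def)
  then have "\<forall>\<^sub>F k in sequentially. m k < 10/9 * \<mu>"
    by (intro order_tendstoD(2)[OF lim]) simp
  then obtain k where k: "m k < 10/9 * \<mu>"
    by (auto simp: eventually_sequentially)
  show thesis
  proof
    show "measure lborel (tail_cantor \<xi> k) \<ge> 9/10 * interval_length \<xi> k"
      using k by (simp add: tail m_def field_simps)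
    have "m (Suc k) \<ge> 9/10 * m k" using k ge[of "Suc k"] by simp
    then show "interval_length \<xi> (Suc k) \<ge> 9/20 * interval_length \<xi> k"
      by (simp add: m_def)
  qed
qed

end

section \<open>Overlaps under shifts into a gap\<close>

text \<open>Inclusion and exclusion: \<open>C\<close> and its translate lie together in an interval
  of length \<open>l + \<bar>s\<bar>\<close>.\<close>

lemma measure_interval_Int_translate:
  fixes C :: "real set"
  assumes "C \<in> sets borel" "C \<subseteq> {0..l}" "\<bar>s\<bar> \<le> l"
  shows "measure lborel (C \<inter> {x. x - s \<in> C}) \<ge> 2 * measure lborel C - l - \<bar>s\<bar>"
proof -
  define D where "D = {x. x - s \<in> C}"
  have bor [measurable]: "C \<in> sets borel" "D \<in> sets borel"
    using assms(1) measurable_sets_borel[of "\<lambda>x. x - s" borel C] by (auto simp: D_def vimage_def)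
  have C_bounds: "0 \<le> x \<and> x \<le> l" if "x \<in> C" for x
    using that assms(2) by auto
  define I where "I = {min 0 s..max l (l + s)}"
  have sub: "C \<subseteq> I"
    using assms(2) by (auto simp: I_def min_le_iff_disj le_max_iff_disj)
  have sub': "D \<subseteq> I"
  proof
    fix x assume "x \<in> D"
    then have "0 \<le> x - s" "x - s \<le> l" using C_bounds[of "x - s"] by (auto simp: D_def)
    then show "x \<in> I" unfolding I_def atLeastAtMost_iff by linarith
  qed
  have fin: "X \<in> fmeasurable lborel" if "X \<in> sets borel" "X \<subseteq> I" for X
    by (rule fmeasurableI2[of I]) (use that in \<open>simp_all add: I_def fmeasurable_compact\<close>)
  have "measure lborel C + measure lborel D - measure lborel (C \<inter> D) = measure lborel (C \<union> D)"
    using measure_Un3[OF fin[OF bor(1) sub] fin[OF bor(2) sub']] by simp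
  also have "\<dots> \<le> measure lborel I"
    using sub sub' by (intro measure_mono_fmeasurable fin) (simp_all add: I_def)
  also have "\<dots> = l + \<bar>s\<bar>" using assms(3) by (simp add: I_def min_def max_def, linarith)
  also have "measure lborel D = measure lborel C"
    unfolding D_def using bor(1) by (rule measure_translate)
  finally show ?thesis by (simp add: D_def)
qed

text \<open>The interval \<open>{u..v}\<close> lies in the gap opened next in the leftmost interval
  of a step \<open>k\<close> at which the set is dense. If \<open>y\<close> lies in the interval of
  step \<open>k\<close> that starts at \<open>a\<close>, then shifting the copy of the tail at
  \<open>a\<close> by \<open>x - y\<close> amounts to shifting the leftmost copy by
  \<open>s = a + (x - y)\<close>. The size of \<open>s\<close> is at most \<open>l - l'\<close>, and
  a dense copy must overlap itself under such a shift.\<close>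

lemma cantor_set_gap:
  assumes "symmetric_cantor_set E" "measure lborel E > 0"
  obtains u v \<delta> c :: real where "u < v" "\<delta> > 0" "c > 0"
    "\<And>x y. x \<in> {u..v} \<Longrightarrow> y \<in> E \<Longrightarrow> \<bar>x - y\<bar> \<ge> \<delta>"
    "\<And>x y. x \<in> {u..v} \<Longrightarrow> y \<in> E \<Longrightarrow> measure lborel (E \<inter> {z. z - (x - y) \<in> E}) \<ge> c"
proof -
  obtain \<xi> where r: "\<forall>k\<ge>1. 0 < \<xi> k \<and> \<xi> k < 1/2" and E: "E = cantor_set \<xi>"
    using assms(1) by (auto simp: symmetric_cantor_set_def)
  obtain k where k: "measure lborel (tail_cantor \<xi> k) \<ge> 9/10 * interval_length \<xi> k"
      "interval_length \<xi> (Suc k) \<ge> 9/20 * interval_length \<xi> k"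
    using dense_tail[OF r] assms(2) unfolding E by blast
  define l l' where "l = interval_length \<xi> k" and "l' = interval_length \<xi> (Suc k)"
  have l: "0 < l'" "2 * l' < l"
    using interval_length_pos[OF r] interval_length_Suc_less[OF r] by (auto simp: l_def l'_def)
  define C where "C = tail_cantor \<xi> k"
  have C: "C \<subseteq> {0..l}" "C \<in> sets borel"
    using tail_cantor_subset[OF r] compact_tail_cantor[OF r] borel_compact by (auto simp: C_def l_def)
  have E_borel: "compact E"
    unfolding E cantor_set_eq by (rule compact_tail_cantor[OF r])
  \<comment> \<open>A quarter of the gap: removing it at both ends leaves the middle half, at
    distance at least \<eta> from the set.\<close>
  define \<eta> where "\<eta> = (l - 2 * l') / 4"
  have gap: "x \<le> l' \<or> x \<ge> l - l'" if "x \<in> E" for x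
    using cantor_set_misses_first_gap[OF r, of x k] that by (auto simp: E l_def l'_def)
  show thesis
  proof (rule that[of "l' + \<eta>" "l - l' - \<eta>" \<eta> "l / 4"])
    show "\<eta> > 0" using l by (simp add: \<eta>_def)
    show "l' + \<eta> < l - l' - \<eta>" "l / 4 > 0" using l by (auto simp: \<eta>_def field_simps)
    fix x y assume x: "x \<in> {l' + \<eta>..l - l' - \<eta>}" and y: "y \<in> E"
    show "\<bar>x - y\<bar> \<ge> \<eta>" using x gap[OF y] by auto
    obtain a where a: "a \<in> tail_starts \<xi> 0 k" "a \<le> y" "y \<le> a + l"
      using cantor_set_in_level[of y \<xi> k] y by (auto simp: E tail_level_def l_def)
    define s where "s = a + (x - y)"
    \<comment> \<open>The extreme shifts occur when \<open>y\<close> is an endpoint of its interval,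
      and \<open>x\<close> stays at least \<open>l'\<close> away from both ends of
      \<open>{0..l}\<close>.\<close>
    have "\<bar>s\<bar> \<le> l - l'" using a x \<open>\<eta> > 0\<close> by (simp add: s_def abs_le_iff)
    \<comment> \<open>Both density bounds enter: 2 * 9/10 - 1 - (1 - 9/20) = 1/4.\<close>
    have "l / 4 \<le> 2 * measure lborel C - l - \<bar>s\<bar>"
      using k \<open>\<bar>s\<bar> \<le> l - l'\<close> by (simp add: C_def l_def l'_def)
    also have "\<dots> \<le> measure lborel (C \<inter> {x. x - s \<in> C})"
      using \<open>\<bar>s\<bar> \<le> l - l'\<close> l by (intro measure_interval_Int_translate C) auto
    also have "\<dots> \<le> measure lborel (E \<inter> {z. z - (x - y) \<in> E})"
    proof (rule measure_mono_fmeasurable)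
      show "C \<inter> {x. x - s \<in> C} \<subseteq> E \<inter> {z. z - (x - y) \<in> E}"
      proof safe
        fix z assume z: "z \<in> C" "z - s \<in> C"
        show "z \<in> E"
          using translate_tail_cantor_subset[OF r zero_in_tail_starts, of z k] z by (simp add: C_def E)
        show "z - (x - y) \<in> E"
          using translate_tail_cantor_subset[OF r a(1), of "z - s"] z
          by (simp add: C_def E s_def algebra_simps)
      qed
      have [measurable]: "C \<in> sets borel" "E \<in> sets borel"
        using C E_borel borel_compact by auto
      show "C \<inter> {x. x - s \<in> C} \<in> sets lborel" by measurable
      have "E \<inter> {z. z - (x - y) \<in> E} \<in> sets lborel" by measurable
      then show "E \<inter> {z. z - (x - y) \<in> E} \<in> fmeasurable lborel"
        by (intro fmeasurableI2[OF fmeasurable_compact[OF E_borel]]) auto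
    qed
    finally show "l / 4 \<le> measure lborel (E \<inter> {z. z - (x - y) \<in> E})" .
  qed
qed

section \<open>Reduction of the product to a Borel set\<close>

lemma compact_symmetric_cantor_set:
  assumes "symmetric_cantor_set E"
  shows "compact E"
proof -
  obtain \<xi> where \<xi>: "\<forall>k\<ge>1. 0 < \<xi> k \<and> \<xi> k < 1/2" "E = cantor_set \<xi>"
    using assms unfolding symmetric_cantor_set_def by blast
  then show ?thesis by (simp add: cantor_set_eq compact_tail_cantor)
qed

theorem theorem1p9:
  fixes E :: "real set" and B :: "(real ^ 'm) set"
  assumes "symmetric_cantor_set E"
    and "emeasure lebesgue E > 0"
    and "bounded B"
    and "B \<in> sets lebesgue"
  shows "\<not> spectral (E \<times> B)"
proof
  assume spec: "spectral (E \<times> B)"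
  have "compact E" using assms(1) by (rule compact_symmetric_cantor_set)
  then have E: "E \<in> sets borel" "bounded E" "E \<in> fmeasurable lborel"
    by (auto intro: borel_compact compact_imp_bounded fmeasurable_compact)
  have E_pos: "measure lborel E > 0"
    using assms(2) E by (auto simp: measure_def enn2real_positive_iff fmeasurable_def)
  \<comment> \<open>\<open>B0\<close> is a Borel subset of \<open>B\<close> with
    \<open>B - B0\<close> inside the null set \<open>N'\<close>, so \<open>E \<times> B\<close> and
    \<open>E \<times> B0\<close> differ by a null set.\<close>
  obtain B0 N N' where B: "B = B0 \<union> N" "N \<subseteq> N'" "N' \<in> null_sets lborel" "B0 \<in> sets lborel"
    using sets_completionE[OF assms(4)] by metis
  have "B0 \<subseteq> B" "B - B0 \<subseteq> N'" using B(1,2) by auto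
  have B0: "B0 \<in> sets borel" "bounded B0"
    using B(4) bounded_subset[OF assms(3) \<open>B0 \<subseteq> B\<close>] by simp_all
  have S: "E \<times> B0 \<in> sets borel" "E \<times> B0 \<subseteq> E \<times> B"
    using borel_Times[OF E(1) B0(1)] \<open>B0 \<subseteq> B\<close> by auto
  have "E \<times> N' \<in> null_sets lborel"
    using null_setsD1[OF B(3)] null_setsD2[OF B(3)] E(1)
    by (intro null_setsI) (simp_all add: emeasure_lborel_Times borel_Times)
  then have "E \<times> N' \<in> null_sets lebesgue" by (rule null_sets_completionI)
  moreover have "E \<times> B - E \<times> B0 \<subseteq> E \<times> N'" using \<open>B - B0 \<subseteq> N'\<close> by auto
  ultimately have null: "E \<times> B - E \<times> B0 \<in> null_sets lebesgue"
    by (rule null_sets_completion_subset[rotated])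
  obtain L where L: "bounded (E \<times> B)" "E \<times> B \<in> sets lebesgue" "emeasure lebesgue (E \<times> B) > 0"
    "orthogonal_exponentials L (E \<times> B)" "complete_exponentials L (E \<times> B)"
    using spec unfolding spectral_def by (elim conjE exE)
  \<comment> \<open>Positivity comes from the definition of \<open>spectral\<close>, which thereby
    settles the case of a null set \<open>B\<close>.\<close>
  have "measure lborel (E \<times> B0) > 0"
  proof -
    have "emeasure lebesgue (E \<times> B) = emeasure lebesgue ((E \<times> B0) \<union> (E \<times> B - E \<times> B0))"
      using S(2) by (simp add: Un_absorb1)
    also have "\<dots> = emeasure lebesgue (E \<times> B0)"
      using S(1) null by (intro emeasure_Un_null_set) auto
    finally have "emeasure lborel (E \<times> B0) > 0" using L(3) S(1) by simp
    moreover have "E \<times> B0 \<in> fmeasurable lborel"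
      using S L(1) by (auto intro: bounded_borel_fmeasurable bounded_subset)
    ultimately show ?thesis by (auto simp: measure_def enn2real_positive_iff fmeasurable_def)
  qed
  then have pair: "spectral_pair (E \<times> B0) L"
    using L S null by (intro spectral_pairI[of "E \<times> B"])
  show False
  proof (rule cantor_set_gap[OF assms(1) E_pos])
    fix u v \<delta> c :: real
    assume gap: "u < v" "\<delta> > 0" "c > 0"
      "\<And>x y. x \<in> {u..v} \<Longrightarrow> y \<in> E \<Longrightarrow> \<bar>x - y\<bar> \<ge> \<delta>"
      "\<And>x y. x \<in> {u..v} \<Longrightarrow> y \<in> E \<Longrightarrow> measure lborel (E \<inter> {z. z - (x - y) \<in> E}) \<ge> c"
    show False
      using no_spectral_pair[OF E(1,2) B0 gap] pair by simp
  qed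
qed

end
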